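(* Let $\mathbb{F}_q$ be a fixed finite field with $q$ odd and $q\equiv 1 \pmod 4$. Then for every $\varepsilon>0$, as $g\to\infty$, $$\sum_{\substack{P \text{ monic irreducible}\\ \deg P=2g+1}}(\log_q|P|)\,L(\tfrac12,\chi_P)=\frac{|P|}{2}\big(\log_q|P|+1\big)+O\big(|P|^{3/4+\varepsilon}\big),$$ where on the right-hand side $|P|=q^{2g+1}$ and $\log_q|P|=2g+1$.
   Context: $A=\mathbb{F}_q[T]$. For nonzero $f\in A$, $|f|=q^{\deg f}$. For a monic irreducible $Q\in A$ and $a\in A$, the quadratic residue symbol $\left(\frac{a}{Q}\right)$ equals $0$ if $Q\mid a$, $1$ if $a$ is a nonzero square modulo $Q$, and $-1$ otherwise; for monic $f=\prod_i Q_i^{e_i}$ (distinct monic irreducibles $Q_i$) one sets $\left(\frac{a}{f}\right)=\prod_i\left(\frac{a}{Q_i}\right)^{e_i}$, with $\left(\frac{a}{1}\right)=1$. For a monic irreducible $P$, $\chi_P(f)=\left(\frac{P}{f}\right)$ for monic $f$. For $P$ monic irreducible of odd degree $2g+1$, $L(s,\chi_P)=\sum_{f\text{ monic}}\chi_P(f)|f|^{-s}$ ($\Re s>1$) is a polynomial in $u=q^{-s}$ of degree $2g$ (the sum of $\chi_P(f)$ over monic $f$ of degree $n$ vanishes for $n\ge 2g+1$), i.e. $L(s,\chi_P)=\sum_{n=0}^{2g}\big(\sum_{f\text{ monic},\deg f=n}\chi_P(f)\big)u^n$, and $L(\tfrac12,\chi_P)$ denotes its value at $u=q^{-1/2}$.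 Implied constants may depend on $q$ and $\varepsilon$. *)

theory Defs
  imports "HOL-Computational_Algebra.Computational_Algebra" "HOL-Library.Landau_Symbols"
begin

definition monic :: "'a::field_gcd poly \<Rightarrow> bool" where
  "monic f \<longleftrightarrow> lead_coeff f = 1"

definition monic_deg :: "nat \<Rightarrow> 'a::field_gcd poly set" where
  "monic_deg n = {f. monic f \<and> degree f = n}"

definition monic_irred_deg :: "nat \<Rightarrow> 'a::field_gcd poly set" where
  "monic_irred_deg n = {P. monic P \<and> irreducible P \<and> degree P = n}"

definition poly_abs :: "'a::{finite,field_gcd} poly \<Rightarrow> real" where
  "poly_abs f = real (card (UNIV::'a set)) ^ degree f"

definition qr_prime :: "'a::field_gcd poly \<Rightarrow> 'a poly \<Rightarrow> int" where
  "qr_prime a Q = (if Q dvd a then 0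
      else if (\<exists>x. Q dvd (x\<^sup>2 - a)) then 1 else -1)"

definition qr_symbol :: "'a::field_gcd poly \<Rightarrow> 'a poly \<Rightarrow> int" where
  "qr_symbol a f = (\<Prod>Q\<in>#prime_factorization f. qr_prime a Q)"

definition chi :: "'a::field_gcd poly \<Rightarrow> 'a poly \<Rightarrow> int" where
  "chi P f = qr_symbol P f"

text \<open>L(1/2, chi_P) for P monic irreducible of odd degree 2g+1: the polynomial
  sum_{n=0}^{2g} (sum_{f monic, deg f = n} chi_P(f)) u^n evaluated at u = q^(-1/2).\<close>
definition L_half :: "'a::{finite,field_gcd} poly \<Rightarrow> real" where
  "L_half P = (\<Sum>n<degree P.
      real_of_int (\<Sum>f\<in>monic_deg n. chi P f) * (real (card (UNIV::'a set)) powr (-1/2)) ^ n)"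

end

theory Submission
  imports Defs "HOL-Number_Theory.Cong"
begin

text \<open>
  Reciprocity turns the Dirichlet series of the prime P into the sum over monic f of (f/P), whose coefficients
  satisfy a functional equation relating degrees n and 2g - n; hence only f of degree at most g matter. Perfect
  squares f contribute the main term through the prime polynomial theorem. For nonsquare f the sum of (f/P)
  over P of degree 2g + 1 shows square-root cancellation, proved by Stepanov's method.

  Reciprocity and the functional equation both come from the quadratic form sending x modulo f to the
  coefficient of 1/T in x^2/f. Instead of additive characters it is tested against an arbitrary real weight w on
  the field with total mass 0, which suffices because a nonzero linear form takes all values equally often.
\<close>

section \<open>Polynomials of bounded degree over a finite field\<close>

text \<open>The truncation at degree g is forced by the error terms. For a nonsquare f of degree n,
  Stepanov's method bounds the sum of (f/P) over P, each P having weight 2g + 1, by a multiple of g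
  q^(g+1). Summed over q^n polynomials f and scaled by q^(-n/2) this is g q^(n/2 + g + 1): at n = 2g
  as large as the main term, but for n <= g at most g q^(3g/2 + 1), which is the exponent 3/4. The
  main term counts the even n among 0..g and 0..g-1; there are g + 1 of them, each worth |P|.

  Stepanov's method bounds numbers of primes only from above. It is therefore applied to both values
  of the symbol, and the prime polynomial theorem turns the two upper bounds into a bound for the
  difference.

  Quadratic sums only have to be compared: reciprocity asks for a sign, read off with a w for which
  both evaluations are positive, and the functional equation asks for a ratio. The condition q = 1
  mod 4 enters through a square root of -1 in the field, used in this positivity argument.\<close>

definition deg_lt :: "nat \<Rightarrow> 'a::field_gcd poly set" where
  "deg_lt n = {h. \<forall>i\<ge>n. coeff h i = 0}"

text \<open>For monic f this is the coefficient of 1/T in the Laurent expansion of h/f at infinity.\<close>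
definition residue_coeff :: "'a::field_gcd poly \<Rightarrow> 'a poly \<Rightarrow> 'a" where
  "residue_coeff f h = coeff (h mod f) (degree f - 1)"

text \<open>The definition by coefficients makes \<open>deg_lt n\<close> visibly a vector space. The
  degree form needs a separate case, since the zero polynomial has \<open>degree\<close> 0 and yet
  lies in \<open>deg_lt 0\<close>.\<close>

lemma mem_deg_lt_iff: "h \<in> deg_lt n \<longleftrightarrow> h = 0 \<or> degree h < n"
  unfolding deg_lt_def
  by (auto simp: coeff_eq_0) (metis leading_coeff_0_iff not_le_imp_less)

lemma deg_lt_0 [simp]: "deg_lt 0 = {0}"
  by (auto simp: mem_deg_lt_iff)

lemma zero_in_deg_lt [simp]: "0 \<in> deg_lt n"
  by (simp add: deg_lt_def)

lemma deg_lt_add: "x \<in> deg_lt n \<Longrightarrow> y \<in> deg_lt n \<Longrightarrow> x + y \<in> deg_lt n"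
  by (simp add: deg_lt_def)

lemma deg_lt_diff: "x \<in> deg_lt n \<Longrightarrow> y \<in> deg_lt n \<Longrightarrow> x - y \<in> deg_lt n"
  by (simp add: deg_lt_def)

lemma deg_lt_smult: "x \<in> deg_lt n \<Longrightarrow> smult c x \<in> deg_lt n"
  by (simp add: deg_lt_def)

lemma deg_lt_mono: "m \<le> n \<Longrightarrow> deg_lt m \<subseteq> deg_lt n"
  by (auto simp: deg_lt_def)

lemma deg_lt_sum: "(\<And>i. i \<in> A \<Longrightarrow> h i \<in> deg_lt n) \<Longrightarrow> sum h A \<in> deg_lt n"
  by (simp add: deg_lt_def coeff_sum)

text \<open>The factors have degree at most m - 1 and n - 1, so the product has degree at most m + n
  - 2; hence the \<open>Suc\<close>. If m or n is 0, one factor is zero.\<close>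

lemma deg_lt_mult:
  assumes "x \<in> deg_lt m" "y \<in> deg_lt n" "m + n \<le> Suc k"
  shows "x * y \<in> deg_lt k"
proof (cases "x = 0 \<or> y = 0")
  case False
  then have "degree x < m" "degree y < n" using assms by (auto simp: mem_deg_lt_iff)
  then show ?thesis using False assms(3) by (simp add: mem_deg_lt_iff degree_mult_eq)
qed auto

lemma deg_lt_monom: "m < n \<Longrightarrow> monom c m \<in> deg_lt n"
  by (simp add: deg_lt_def)

lemma deg_lt_degree_le: "h \<in> deg_lt (Suc n) \<longleftrightarrow> degree h \<le> n"
  by (auto simp: mem_deg_lt_iff)

text \<open>Splitting off the top coefficient serves both to count \<open>deg_lt n\<close> and to
  isolate leading coefficients in later sums over residues.\<close>

lemma bij_betw_deg_lt_Suc: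
  "bij_betw (\<lambda>(c, y). monom c k + y) (UNIV \<times> deg_lt k) (deg_lt (Suc k) :: 'a::field_gcd poly set)"
  unfolding bij_betw_def
proof
  show "inj_on (\<lambda>(c, y). monom c k + y) (UNIV \<times> (deg_lt k :: 'a poly set))"
  proof (rule inj_onI, clarify)
    fix c c' :: 'a and y y' :: "'a poly"
    assume y: "y \<in> deg_lt k" "y' \<in> deg_lt k" and eq: "monom c k + y = monom c' k + y'"
    have "coeff (monom c k + y) k = coeff (monom c' k + y') k" using eq by simp
    then have "c = c'" using y by (simp add: deg_lt_def)
    then show "c = c' \<and> y = y'" using eq by simp
  qed
  show "(\<lambda>(c, y). monom c k + y) ` (UNIV \<times> deg_lt k) = (deg_lt (Suc k) :: 'a poly set)"
  proof safe
    fix c :: 'a and y :: "'a poly" assume "y \<in> deg_lt k"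
    then show "monom c k + y \<in> deg_lt (Suc k)" by (auto simp: deg_lt_def)
  next
    fix x :: "'a poly" assume x: "x \<in> deg_lt (Suc k)"
    have "x - monom (coeff x k) k \<in> deg_lt k"
      using x unfolding deg_lt_def by (auto simp: le_Suc_eq dest: le_neq_implies_less)
    then show "x \<in> (\<lambda>(c, y). monom c k + y) ` (UNIV \<times> deg_lt k)"
      by (intro image_eqI[where x = "(coeff x k, x - monom (coeff x k) k)"]) auto
  qed
qed

lemma sum_deg_lt_Suc:
  fixes F :: "'a::{finite,field_gcd} poly \<Rightarrow> 'b::comm_monoid_add"
  shows "sum F (deg_lt (Suc k)) = (\<Sum>c\<in>UNIV. \<Sum>y\<in>deg_lt k. F (monom c k + y))"
proof -
  have "sum F (deg_lt (Suc k)) = (\<Sum>z\<in>UNIV \<times> deg_lt k. F (case z of (c, y) \<Rightarrow> monom c k + y))"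
    by (rule sum.reindex_bij_betw[OF bij_betw_deg_lt_Suc, symmetric])
  then show ?thesis by (simp add: sum.cartesian_product split_def)
qed

lemma finite_card_deg_lt:
  "finite (deg_lt n :: 'a::{finite,field_gcd} poly set) \<and> card (deg_lt n :: 'a poly set) = card (UNIV :: 'a set) ^ n"
proof (induction n)
  case (Suc n)
  then show ?case
    using bij_betw_finite[OF bij_betw_deg_lt_Suc[of n, where ?'a='a]]
          bij_betw_same_card[OF bij_betw_deg_lt_Suc[of n, where ?'a='a]]
    by (auto simp: card_cartesian_product)
qed auto

lemma finite_deg_lt [simp, intro]: "finite (deg_lt n :: 'a::{finite,field_gcd} poly set)"
  using finite_card_deg_lt by blast

lemma card_deg_lt: "card (deg_lt n :: 'a::{finite,field_gcd} poly set) = card (UNIV :: 'a set) ^ n"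
  using finite_card_deg_lt by blast

lemma mod_in_deg_lt: "P \<noteq> 0 \<Longrightarrow> h mod P \<in> deg_lt (degree P)"
  using degree_mod_less[of P h] by (auto simp: mem_deg_lt_iff)

lemma mod_deg_lt_id: "h \<in> deg_lt (degree P) \<Longrightarrow> h mod P = h"
  by (auto simp: mem_deg_lt_iff mod_poly_less)

lemma cong_deg_lt_imp_eq: "x \<in> deg_lt (degree P) \<Longrightarrow> y \<in> deg_lt (degree P) \<Longrightarrow> [x = y] (mod P) \<Longrightarrow> x = y"
  by (simp add: cong_def mod_deg_lt_id)

lemma monic_deg_eq_image: "(monic_deg n :: 'a::field_gcd poly set) = (\<lambda>y. monom 1 n + y) ` deg_lt n"
proof safe
  fix f :: "'a poly" assume "f \<in> monic_deg n"
  then have "f - monom 1 n \<in> deg_lt n"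
    unfolding monic_deg_def monic_def deg_lt_def
    by (auto simp: coeff_eq_0 le_less)
  then show "f \<in> (\<lambda>y. monom 1 n + y) ` deg_lt n"
    by (intro image_eqI[where x = "f - monom 1 n"]) auto
next
  fix y :: "'a poly" assume y: "y \<in> deg_lt n"
  have "degree (monom 1 n + y) = n"
    by (rule antisym) (use y in \<open>auto intro!: le_degree degree_le simp: deg_lt_def\<close>)
  then show "monom 1 n + y \<in> monic_deg n"
    using y unfolding monic_deg_def monic_def by (auto simp: deg_lt_def)
qed

lemma sum_monic_deg: "sum F (monic_deg n) = (\<Sum>y\<in>deg_lt n. F (monom 1 n + y))"
  unfolding monic_deg_eq_image by (subst sum.reindex) (auto simp: inj_on_def)

lemma finite_monic_deg [simp, intro]: "finite (monic_deg n :: 'a::{finite,field_gcd} poly set)"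
  by (simp add: monic_deg_eq_image)

lemma card_monic_deg: "card (monic_deg n :: 'a::{finite,field_gcd} poly set) = card (UNIV :: 'a set) ^ n"
  unfolding monic_deg_eq_image by (subst card_image) (auto simp: inj_on_def card_deg_lt)

lemma finite_monic_irred_deg [simp, intro]: "finite (monic_irred_deg n :: 'a::{finite,field_gcd} poly set)"
  by (rule finite_subset[OF _ finite_monic_deg[of n]]) (auto simp: monic_irred_deg_def monic_deg_def)

lemma monic_irred_degD:
  assumes "P \<in> monic_irred_deg n"
  shows "irreducible P" "prime_elem P" "degree P = n" "lead_coeff P = 1" "P \<noteq> 0" "n > 0"
proof -
  show a: "irreducible P" "degree P = n" "lead_coeff P = 1" "P \<noteq> 0"
    using assms by (auto simp: monic_irred_deg_def monic_def)
  then show "prime_elem P" by (simp add: prime_elem_iff_irreducible)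
  show "n > 0"
  proof (rule ccontr)
    assume "\<not> n > 0"
    then have "is_unit P" using a by (simp add: is_unit_iff_degree)
    then show False using a irreducible_not_unit by blast
  qed
qed

lemma X_power: "[:0, 1:] ^ n = (monom 1 n :: 'a::comm_semiring_1 poly)"
  by (simp add: monom_altdef)

lemma normalize_monic:
  fixes f :: "'a::field_gcd poly"
  assumes "lead_coeff f = 1"
  shows "normalize f = f"
proof -
  have "unit_factor f = 1" using assms by (simp add: unit_factor_poly_def one_pCons)
  then show ?thesis by (metis mult_1 unit_factor_mult_normalize)
qed

lemma prime_iff_monic_irred:
  fixes P :: "'a::field_gcd poly"
  shows "prime P \<longleftrightarrow> irreducible P \<and> lead_coeff P = 1"
proof
  assume P: "prime P"
  then have "unit_factor P = 1" "P \<noteq> 0" by (auto simp: unit_factor_prime)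
  then have "unit_factor (lead_coeff P) = 1" by (simp add: unit_factor_poly_def one_pCons)
  moreover have "is_unit (lead_coeff P)" using \<open>P \<noteq> 0\<close> by (simp add: dvd_field_iff)
  ultimately have "lead_coeff P = 1" by (simp add: is_unit_unit_factor)
  then show "irreducible P \<and> lead_coeff P = 1"
    using P by (simp add: prime_imp_prime_elem prime_elem_imp_irreducible)
next
  assume P: "irreducible P \<and> lead_coeff P = 1"
  then have "unit_factor P = 1" by (simp add: unit_factor_poly_def one_pCons)
  then have "normalize P = P" by (metis mult_1 unit_factor_mult_normalize)
  then show "prime P" using P by (simp add: prime_def prime_elem_iff_irreducible)
qed

lemma irreducible_X: "irreducible ([:0, 1:] :: 'a::field_gcd poly)"
proof (rule irreducibleI)
  fix a b :: "'a poly" assume ab: "[:0, 1:] = a * b"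
  then have nz: "a \<noteq> 0" "b \<noteq> 0" by auto
  have "degree (a * b) = 1" by (simp flip: ab)
  then have "degree a = 0 \<or> degree b = 0" using nz by (auto simp: degree_mult_eq add_is_1)
  then show "a dvd 1 \<or> b dvd 1" using nz by (simp add: is_unit_iff_degree)
qed (auto simp: is_unit_iff_degree)

text \<open>T is a prime whose residue field is F_q itself, so facts modulo a prime polynomial
  specialize to facts about field elements.\<close>

lemma X_in_monic_irred: "[:0, 1:] \<in> (monic_irred_deg 1 :: 'a::field_gcd poly set)"
  by (simp add: monic_irred_deg_def monic_def irreducible_X)

section \<open>Multiplication modulo a prime, Fermat's theorem and the Frobenius map\<close>

lemma not_dvd_deg_lt:
  assumes "h \<in> deg_lt (degree P)" "h \<noteq> 0"
  shows "\<not> P dvd h"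
  using assms by (auto simp: mem_deg_lt_iff dest!: dvd_imp_degree_le)

lemma prime_elem_dvd_prod_iff:
  assumes "finite A" "prime_elem p"
  shows "p dvd prod f A \<longleftrightarrow> (\<exists>x\<in>A. p dvd f x)"
  using assms by (induction A rule: finite_induct) (auto simp: prime_elem_dvd_mult_iff dest: prime_elem_not_unit)

lemma pcompose_power: "pcompose (p ^ n) r = pcompose p r ^ n"
  for p r :: "'a::comm_semiring_1 poly"
  by (induction n) (simp_all add: pcompose_1 pcompose_mult)

lemma bij_betw_mult_mod:
  fixes P :: "'a::{finite,field_gcd} poly"
  assumes P: "prime_elem P" and a: "\<not> P dvd a"
  shows "bij_betw (\<lambda>x. (a * x) mod P) (deg_lt (degree P)) (deg_lt (degree P))"
  unfolding bij_betw_def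
proof
  have [simp]: "P \<noteq> 0" using P by auto
  show inj: "inj_on (\<lambda>x. (a * x) mod P) (deg_lt (degree P))"
  proof (rule inj_onI)
    fix x y assume xy: "x \<in> deg_lt (degree P)" "y \<in> deg_lt (degree P)" "(a * x) mod P = (a * y) mod P"
    then have "P dvd a * (x - y)" by (simp add: mod_eq_dvd_iff algebra_simps)
    then have "P dvd x - y" using P a by (simp add: prime_elem_dvd_mult_iff)
    then show "x = y" using xy deg_lt_diff not_dvd_deg_lt by (metis eq_iff_diff_eq_0)
  qed
  show "(\<lambda>x. (a * x) mod P) ` deg_lt (degree P) = deg_lt (degree P)"
    by (rule card_subset_eq) (use inj in \<open>auto simp: mod_in_deg_lt card_image\<close>)
qed

text \<open>Multiplication by a permutes the nonzero residues, so their product is multiplied by a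
  power of a and yet unchanged modulo P; the product is prime to P and cancels.\<close>

lemma fermat_poly:
  fixes P :: "'a::{finite,field_gcd} poly"
  assumes P: "prime_elem P" and a: "\<not> P dvd a"
  shows "[a ^ (card (UNIV :: 'a set) ^ degree P - 1) = 1] (mod P)"
proof -
  let ?U0 = "deg_lt (degree P) - {0} :: 'a poly set"
  have bij: "bij_betw (\<lambda>x. (a * x) mod P) ?U0 ?U0"
    using bij_betw_DiffI[OF bij_betw_mult_mod[OF assms], of "{0}" "{0}"] by (simp add: bij_betw_def)
  have "[prod (\<lambda>x. a * x) ?U0 = prod (\<lambda>x. (a * x) mod P) ?U0] (mod P)"
    by (rule cong_prod) (simp add: cong_def)
  also have "prod (\<lambda>x. (a * x) mod P) ?U0 = prod (\<lambda>x. x) ?U0"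
    by (rule prod.reindex_bij_betw[OF bij])
  also have "prod (\<lambda>x. a * x) ?U0 = a ^ card ?U0 * prod (\<lambda>x. x) ?U0"
    by (simp add: prod.distrib)
  finally have "P dvd (a ^ card ?U0 - 1) * prod (\<lambda>x. x) ?U0"
    by (simp add: cong_iff_dvd_diff algebra_simps)
  moreover have "\<not> P dvd prod (\<lambda>x. x) ?U0"
    using not_dvd_deg_lt by (auto simp: prime_elem_dvd_prod_iff[OF _ P])
  ultimately have "P dvd a ^ card ?U0 - 1"
    using P prime_elem_dvd_mult_iff by blast
  then show ?thesis by (simp add: cong_iff_dvd_diff card_deg_lt)
qed

lemma fermat_field:
  fixes c :: "'a::{finite,field_gcd}"
  shows "c ^ card (UNIV :: 'a set) = c"
proof (cases "c = 0")
  case False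
  let ?q = "card (UNIV :: 'a set)"
  have "\<not> [:0, 1:] dvd [:c:]" using False by (auto dest!: dvd_imp_degree_le)
  then have "[[:c:] ^ (?q - 1) = 1] (mod [:0, 1:])"
    using fermat_poly[of "[:0,1:]" "[:c:]"] monic_irred_degD(2)[OF X_in_monic_irred] by simp
  then have "[:0,1:] dvd [:c ^ (?q - 1) - 1:]"
    by (simp add: cong_iff_dvd_diff poly_const_pow one_pCons)
  then have "c ^ (?q - 1) = 1"
    by (auto dest!: dvd_imp_degree_le split: if_splits)
  moreover have "?q > 0" by (simp add: card_gt_0_iff)
  ultimately show ?thesis by (metis Suc_diff_1 mult.right_neutral power_Suc)
qed (simp add: card_gt_0_iff)

lemma card_field_gt_1: "card (UNIV :: 'a::{finite,field_gcd} set) > 1"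
proof -
  have "card {0, 1 :: 'a} \<le> card (UNIV :: 'a set)" by (intro card_mono) auto
  then show ?thesis by simp
qed

text \<open>Both sides are monic of degree q and vanish on the whole field, so a nonzero difference
  would have degree below q but q roots.\<close>

lemma prod_linear_field:
  "(\<Prod>c\<in>UNIV. [:- c, 1:]) = monom 1 (card (UNIV :: 'a::{finite,field_gcd} set)) - [:0, 1 :: 'a:]"
  (is "?L = ?R")
proof -
  let ?q = "card (UNIV :: 'a set)"
  have degL: "degree ?L = ?q" by (subst degree_prod_sum_eq) auto
  have lc: "lead_coeff ?L = 1" by (simp add: lead_coeff_prod)
  have "?L - ?R = 0"
  proof (rule ccontr)
    assume nz: "?L - ?R \<noteq> 0"
    have "?L - monom 1 ?q \<in> deg_lt ?q"
      using degL lc by (auto simp: deg_lt_def coeff_eq_0 le_less)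
    moreover have "[:0, 1 :: 'a:] \<in> deg_lt ?q" using card_field_gt_1 by (auto simp: mem_deg_lt_iff)
    ultimately have "?L - monom 1 ?q + [:0, 1:] \<in> deg_lt ?q" by (rule deg_lt_add)
    then have deg: "degree (?L - ?R) < ?q" using nz by (simp add: mem_deg_lt_iff algebra_simps)
    have "poly (?L - ?R) c = 0" for c
      by (simp add: poly_prod poly_monom fermat_field prod_zero_iff)
    then have "card (UNIV :: 'a set) \<le> degree (?L - ?R)"
      using card_poly_roots_bound[OF nz] by simp
    with deg show False by simp
  qed
  then show ?thesis by simp
qed

text \<open>Shifting the variable by 1 permutes the factors of the product of all X - c, which equals X^q - X.\<close>
lemma binomial_vanishes:
  assumes "0 < k" "k < card (UNIV :: 'a::{finite,field_gcd} set)"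
  shows "of_nat (card (UNIV :: 'a set) choose k) = (0 :: 'a)"
proof -
  let ?q = "card (UNIV :: 'a set)"
  let ?X = "[:0, 1:] :: 'a poly"
  have *: "(\<Prod>c\<in>UNIV. [:- c, 1:]) = ?X ^ ?q - ?X"
    by (simp add: prod_linear_field X_power)
  have "pcompose (\<Prod>c\<in>UNIV. [:- c, 1 :: 'a:]) [:1, 1:] = (\<Prod>c\<in>UNIV. [:- (c - 1), 1:])"
    by (simp add: pcompose_prod pcompose_pCons)
  also have "\<dots> = (\<Prod>c\<in>UNIV. [:- c, 1:])"
    by (rule prod.reindex_bij_witness[where i = "\<lambda>c. c + 1" and j = "\<lambda>c. c - 1"]) auto
  finally have "pcompose (?X ^ ?q - ?X) [:1, 1:] = ?X ^ ?q - ?X" unfolding * .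
  then have "[:1, 1:] ^ ?q - (?X + 1) = ?X ^ ?q - ?X"
    by (simp add: pcompose_diff pcompose_power pcompose_pCons one_pCons)
  then have eq: "[:1, 1:] ^ ?q = ?X ^ ?q + 1" by (simp add: algebra_simps)
  have "[:1, 1 :: 'a:] = ?X + 1" by (simp add: one_pCons)
  then have "(?X + 1) ^ ?q = ?X ^ ?q + 1" using eq by simp
  then have "(\<Sum>i\<le>?q. of_nat (?q choose i) * ?X ^ i) = ?X ^ ?q + 1"
    by (simp add: binomial_ring)
  then have "coeff (\<Sum>i\<le>?q. of_nat (?q choose i) * ?X ^ i) k = coeff (?X ^ ?q + 1) k" by simp
  moreover have "of_nat (?q choose i) * ?X ^ i = monom (of_nat (?q choose i)) i" for i
    by (simp add: of_nat_poly monom_altdef)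
  ultimately show ?thesis
    using assms by (simp add: coeff_sum flip: X_power monom_altdef) (simp add: X_power)
qed

text \<open>By \<open>binomial_vanishes\<close> only the two extreme terms of the binomial expansion
  survive in exponent q; higher powers of q follow by iteration.\<close>

lemma frobenius_add:
  fixes x y :: "'a::{finite,field_gcd} poly"
  shows "(x + y) ^ (card (UNIV :: 'a set) ^ k) = x ^ (card (UNIV :: 'a set) ^ k) + y ^ (card (UNIV :: 'a set) ^ k)"
proof (induction k)
  case (Suc k)
  let ?q = "card (UNIV :: 'a set)"
  have base: "(u + v) ^ ?q = u ^ ?q + v ^ ?q" for u v :: "'a poly"
  proof -
    have "(u + v) ^ ?q = (\<Sum>i\<le>?q. of_nat (?q choose i) * u ^ i * v ^ (?q - i))"
      by (rule binomial_ring)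
    also have "\<dots> = (\<Sum>i\<in>{0, ?q}. of_nat (?q choose i) * u ^ i * v ^ (?q - i))"
    proof (rule sum.mono_neutral_right)
      show "\<forall>i\<in>{..?q} - {0, ?q}. of_nat (?q choose i) * u ^ i * v ^ (?q - i) = 0"
      proof
        fix i assume "i \<in> {..?q} - {0, ?q}"
        then have "of_nat (?q choose i) = (0 :: 'a)" by (intro binomial_vanishes) auto
        then have "of_nat (?q choose i) = (0 :: 'a poly)" by (simp add: of_nat_poly)
        then show "of_nat (?q choose i) * u ^ i * v ^ (?q - i) = 0" by simp
      qed
    qed auto
    also have "\<dots> = u ^ ?q + v ^ ?q" using card_field_gt_1[where ?'a='a] by (simp add: add.commute)
    finally show ?thesis .
  qed
  have "(x + y) ^ (?q ^ Suc k) = ((x + y) ^ (?q ^ k)) ^ ?q" by (simp flip: power_mult add: mult.commute)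
  also have "\<dots> = (x ^ (?q ^ k)) ^ ?q + (y ^ (?q ^ k)) ^ ?q" by (simp add: Suc base)
  also have "\<dots> = x ^ (?q ^ Suc k) + y ^ (?q ^ Suc k)" by (simp flip: power_mult add: mult.commute)
  finally show ?case .
qed auto

lemma frobenius_sum:
  fixes F :: "'b \<Rightarrow> 'a::{finite,field_gcd} poly"
  shows "(sum F A) ^ (card (UNIV :: 'a set) ^ k) = (\<Sum>i\<in>A. F i ^ (card (UNIV :: 'a set) ^ k))"
proof (induction A rule: infinite_finite_induct)
  case (insert a A)
  then show ?case by (simp add: frobenius_add)
qed (use card_field_gt_1[where ?'a='a] in \<open>auto simp: power_0_left\<close>)

lemma frobenius_diff:
  fixes x y :: "'a::{finite,field_gcd} poly"
  shows "(x - y) ^ (card (UNIV :: 'a set) ^ k) = x ^ (card (UNIV :: 'a set) ^ k) - y ^ (card (UNIV :: 'a set) ^ k)"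
  using frobenius_add[of "x - y" y k] by (simp add: algebra_simps)

section \<open>The quadratic residue symbol\<close>

lemma qr_prime_cong:
  assumes "[a = b] (mod P)"
  shows "qr_prime a P = qr_prime b P"
proof -
  have "P dvd x\<^sup>2 - a \<longleftrightarrow> P dvd x\<^sup>2 - b" for x
    using assms by (metis cong_iff_dvd_diff cong_sym cong_trans)
  moreover have "P dvd a \<longleftrightarrow> P dvd b" using assms by (rule cong_dvd_iff)
  ultimately show ?thesis by (simp add: qr_prime_def)
qed

lemma qr_prime_cases: "qr_prime a P \<in> {-1, 0, 1}"
  by (simp add: qr_prime_def)

lemma qr_prime_eq_0_iff: "qr_prime a P = 0 \<longleftrightarrow> P dvd a"
  by (simp add: qr_prime_def)

lemma qr_prime_square: "\<not> P dvd x\<^sup>2 \<Longrightarrow> qr_prime (x\<^sup>2) P = 1"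
  by (auto simp: qr_prime_def intro!: exI[of _ x])

lemma ex_residue:
  assumes "P \<noteq> 0"
  obtains y where "y \<in> deg_lt (degree P)" "[x = y] (mod P)"
  using assms mod_in_deg_lt[of P x] by (auto simp: cong_def)

locale odd_field =
  fixes ty :: "'a::{finite,field_gcd} itself" and q :: nat
  assumes q_def: "q = card (UNIV :: 'a set)" and odd_q: "odd q"
begin

lemma q_gt_2: "q > 2"
proof -
  have "q > 1" using card_field_gt_1[where ?'a='a] q_def by simp
  then show ?thesis using odd_q by (cases "q = 2") auto
qed

lemma card_deg_lt_q: "card (deg_lt n :: 'a poly set) = q ^ n"
  by (simp add: card_deg_lt q_def)

text \<open>Translation by 1 permutes the field, so comparing the sums of all elements gives q = 0
  in the field; for odd q, 2 = 0 would then give 1 = 0.\<close>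

lemma two_neq_0: "(2 :: 'a) \<noteq> 0"
proof
  assume two: "(2 :: 'a) = 0"
  obtain k where k: "q = Suc (2 * k)" using odd_q by (auto elim: oddE)
  have "(\<Sum>c\<in>UNIV. c) = (\<Sum>c\<in>UNIV. c + (1 :: 'a))"
    by (rule sum.reindex_bij_witness[where i = "\<lambda>c. c + 1" and j = "\<lambda>c. c - 1"]) auto
  then have "of_nat q = (0 :: 'a)" by (simp add: sum.distrib q_def)
  then have "2 * of_nat k + 1 = (0 :: 'a)" using k by (simp add: add.commute)
  then show False using two by simp
qed

lemma eq_uminus_iff: "(c :: 'a) = - c \<longleftrightarrow> c = 0"
  using two_neq_0 by (metis add_cancel_right_left eq_neg_iff_add_eq_0 mult_2 mult_eq_0_iff neg_0_equal_iff_equal)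

lemma not_dvd_two:
  assumes "prime_elem (P :: 'a poly)"
  shows "\<not> P dvd 2"
proof
  assume "P dvd 2"
  moreover have "is_unit (2 :: 'a poly)"
    using two_neq_0 by (simp add: is_unit_iff_degree numeral_poly)
  ultimately show False using assms prime_elem_not_unit dvd_trans by blast
qed

text \<open>This count links the quadratic form to the symbol: it turns sums over x of a function of
  x^2 into sums over h weighted by 1 + (h/P).\<close>

lemma card_square_roots:
  fixes P :: "'a poly"
  assumes P: "prime_elem P"
  shows "int (card {x \<in> deg_lt (degree P). [x\<^sup>2 = h] (mod P)}) = 1 + qr_prime h P"
proof -
  have [simp]: "P \<noteq> 0" using P by auto
  consider "P dvd h" | "\<not> P dvd h" "\<exists>x. P dvd x\<^sup>2 - h" | "\<not> P dvd h" "\<not> (\<exists>x. P dvd x\<^sup>2 - h)" by blast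
  then show ?thesis
  proof cases
    case 1
    have "[x\<^sup>2 = h] (mod P) \<longleftrightarrow> x = 0" if "x \<in> deg_lt (degree P)" for x
    proof -
      have "[x\<^sup>2 = h] (mod P) \<longleftrightarrow> P dvd x\<^sup>2"
        using 1 by (metis cong_0_iff cong_sym cong_trans)
      also have "\<dots> \<longleftrightarrow> P dvd x" using P by (simp add: prime_elem_dvd_power_iff)
      also have "\<dots> \<longleftrightarrow> x = 0" using that not_dvd_deg_lt by auto
      finally show ?thesis .
    qed
    moreover have "[0 = h] (mod P)" using 1 by (simp add: cong_iff_dvd_diff)
    ultimately have "{x \<in> deg_lt (degree P). [x\<^sup>2 = h] (mod P)} = {0}" by auto
    then show ?thesis using 1 by (simp add: qr_prime_def)
  next
    case 2
    then obtain x' where x': "P dvd x'\<^sup>2 - h" by blast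
    obtain x where x: "x \<in> deg_lt (degree P)" "[x' = x] (mod P)" using ex_residue[of P x'] by auto
    have xh: "[x\<^sup>2 = h] (mod P)"
      using cong_trans[OF cong_sym[OF cong_pow[OF x(2), of 2]]] x' by (simp add: cong_iff_dvd_diff)
    have "\<not> P dvd x\<^sup>2" using cong_dvd_iff[OF xh] 2(1) by simp
    then have ndx: "\<not> P dvd x" using P by (simp add: prime_elem_dvd_power_iff)
    have mx: "- x \<in> deg_lt (degree P)" using x(1) by (simp add: deg_lt_def)
    have "{y \<in> deg_lt (degree P). [y\<^sup>2 = h] (mod P)} = {x, - x}"
    proof (intro set_eqI iffI)
      fix y assume "y \<in> {y \<in> deg_lt (degree P). [y\<^sup>2 = h] (mod P)}"
      then have y: "y \<in> deg_lt (degree P)" "[y\<^sup>2 = h] (mod P)" by auto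
      have "[y\<^sup>2 = x\<^sup>2] (mod P)" using y xh cong_sym cong_trans by blast
      then have "P dvd (y - x) * (y + x)"
        by (simp add: cong_iff_dvd_diff power2_eq_square algebra_simps)
      then have "P dvd y - x \<or> P dvd y - (- x)" using P by (simp add: prime_elem_dvd_mult_iff)
      then show "y \<in> {x, - x}" using y x mx cong_deg_lt_imp_eq unfolding cong_iff_dvd_diff[symmetric] by blast
    qed (use x mx xh in auto)
    moreover have "x \<noteq> - x"
    proof
      assume "x = - x"
      then have "x + x = 0" by (metis add.right_inverse)
      then have "P dvd 2 * x" unfolding mult_2 by (simp only: dvd_0_right)
      then show False using P ndx not_dvd_two[OF P] by (simp add: prime_elem_dvd_mult_iff)
    qed
    ultimately show ?thesis using 2 by (simp add: qr_prime_def)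
  next
    case 3
    then have "{x \<in> deg_lt (degree P). [x\<^sup>2 = h] (mod P)} = {}" by (auto simp: cong_iff_dvd_diff)
    then show ?thesis using 3 by (simp add: qr_prime_def)
  qed
qed

lemma sum_qr_prime_group:
  fixes P :: "'a poly" and F :: "'a poly \<Rightarrow> real"
  assumes P: "prime_elem P"
  shows "(\<Sum>x\<in>deg_lt (degree P). F ((x\<^sup>2) mod P)) = (\<Sum>h\<in>deg_lt (degree P). (1 + real_of_int (qr_prime h P)) * F h)"
proof -
  have [simp]: "P \<noteq> 0" using P by auto
  have "(\<Sum>x\<in>deg_lt (degree P). F ((x\<^sup>2) mod P)) =
      (\<Sum>h\<in>deg_lt (degree P). \<Sum>x\<in>{x \<in> deg_lt (degree P). (x\<^sup>2) mod P = h}. F ((x\<^sup>2) mod P))"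
    by (rule sum.group[symmetric]) (auto simp: mod_in_deg_lt)
  also have "\<dots> = (\<Sum>h\<in>deg_lt (degree P). (1 + real_of_int (qr_prime h P)) * F h)"
  proof (rule sum.cong)
    fix h :: "'a poly" assume h: "h \<in> deg_lt (degree P)"
    have "{x \<in> deg_lt (degree P). (x\<^sup>2) mod P = h} = {x \<in> deg_lt (degree P). [x\<^sup>2 = h] (mod P)}"
      using h by (auto simp: cong_def mod_deg_lt_id)
    then have "int (card {x \<in> deg_lt (degree P). (x\<^sup>2) mod P = h}) = 1 + qr_prime h P"
      using card_square_roots[OF P] by simp
    then have "real (card {x \<in> deg_lt (degree P). (x\<^sup>2) mod P = h}) = 1 + real_of_int (qr_prime h P)"
      by linarith
    moreover have "(\<Sum>x\<in>{x \<in> deg_lt (degree P). (x\<^sup>2) mod P = h}. F ((x\<^sup>2) mod P)) =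
      real (card {x \<in> deg_lt (degree P). (x\<^sup>2) mod P = h}) * F h" by simp
    ultimately show "(\<Sum>x\<in>{x \<in> deg_lt (degree P). (x\<^sup>2) mod P = h}. F ((x\<^sup>2) mod P)) =
      (1 + real_of_int (qr_prime h P)) * F h" by simp
  qed auto
  finally show ?thesis .
qed

lemma sum_qr_prime_eq_0:
  fixes P :: "'a poly"
  assumes P: "prime_elem P"
  shows "(\<Sum>h\<in>deg_lt (degree P). qr_prime h P) = 0"
proof -
  have "(\<Sum>h\<in>(deg_lt (degree P) :: 'a poly set). 1 :: real) = (\<Sum>h\<in>deg_lt (degree P). (1 + real_of_int (qr_prime h P)) * 1)"
    using sum_qr_prime_group[OF P, of "\<lambda>_. 1"] by simp
  then have "real_of_int (\<Sum>h\<in>deg_lt (degree P). qr_prime h P) = 0"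
    by (simp add: sum.distrib)
  then show ?thesis by linarith
qed

lemma sum_mult_mod:
  fixes P :: "'a poly" and F :: "'a poly \<Rightarrow> 'b::comm_monoid_add"
  assumes P: "prime_elem P" "\<not> P dvd a"
  shows "(\<Sum>h\<in>deg_lt (degree P). F ((a * h) mod P)) = (\<Sum>h\<in>deg_lt (degree P). F h)"
  by (rule sum.reindex_bij_betw[OF bij_betw_mult_mod[OF P]])

text \<open>If a = c^2 modulo P, then c is invertible there, and x -> c x matches square roots of b
  with square roots of a b.\<close>

lemma qr_prime_mult_square:
  fixes P :: "'a poly"
  assumes P: "prime_elem P" and a: "qr_prime a P = 1"
  shows "qr_prime (a * b) P = qr_prime b P"
proof -
  from a obtain c where c: "P dvd c\<^sup>2 - a" and na: "\<not> P dvd a"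
    by (auto simp: qr_prime_def split: if_splits)
  have ca: "[c\<^sup>2 = a] (mod P)" using c by (simp add: cong_iff_dvd_diff)
  have nc: "\<not> P dvd c" using ca na P by (metis cong_dvd_iff prime_elem_dvd_power_iff zero_less_numeral)
  have [simp]: "P \<noteq> 0" using P by auto
  have dvd: "P dvd a * b \<longleftrightarrow> P dvd b" using P na by (simp add: prime_elem_dvd_mult_iff)
  have "(\<exists>x. P dvd x\<^sup>2 - a * b) \<longleftrightarrow> (\<exists>x. P dvd x\<^sup>2 - b)"
  proof safe
    fix x assume x: "P dvd x\<^sup>2 - b"
    have "[(c * x)\<^sup>2 = a * b] (mod P)"
      using x ca unfolding power_mult_distrib by (intro cong_mult) (auto simp: cong_iff_dvd_diff)
    then show "\<exists>x. P dvd x\<^sup>2 - a * b" by (auto simp: cong_iff_dvd_diff)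
  next
    fix x assume x: "P dvd x\<^sup>2 - a * b"
    obtain x0 where "x0 \<in> deg_lt (degree P)" and x0: "[x = x0] (mod P)" using ex_residue[of P x] by auto
    then have "x0 \<in> (\<lambda>x. (c * x) mod P) ` deg_lt (degree P)"
      using bij_betw_mult_mod[OF P nc] by (simp add: bij_betw_def)
    then obtain y where y: "(c * y) mod P = x0" by auto
    have "x0 mod P = c * y mod P" using y by (metis mod_mod_trivial)
    then have "[x = c * y] (mod P)" using x0 by (simp add: cong_def)
    then have "[x\<^sup>2 = c\<^sup>2 * y\<^sup>2] (mod P)" by (metis cong_pow power_mult_distrib)
    moreover have "[c\<^sup>2 * y\<^sup>2 = a * y\<^sup>2] (mod P)" using ca by (intro cong_mult) auto
    moreover have "[x\<^sup>2 = a * b] (mod P)" using x by (simp add: cong_iff_dvd_diff)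
    ultimately have "[a * y\<^sup>2 = a * b] (mod P)" by (metis cong_sym cong_trans)
    then have "P dvd a * (y\<^sup>2 - b)" by (simp add: cong_iff_dvd_diff algebra_simps)
    then show "\<exists>x. P dvd x\<^sup>2 - b" using P na by (auto simp: prime_elem_dvd_mult_iff)
  qed
  then show ?thesis using dvd by (simp add: qr_prime_def)
qed

text \<open>The product of two nonresidues is a residue: multiplication by a nonresidue maps residues to
  nonresidues, and both classes have the same size because the symbol sums to zero.\<close>
lemma qr_prime_mult:
  fixes P :: "'a poly"
  assumes P: "prime_elem P"
  shows "qr_prime (a * b) P = qr_prime a P * qr_prime b P"
proof -
  have [simp]: "P \<noteq> 0" using P by auto
  consider "P dvd a" | "P dvd b" | "qr_prime a P = 1" | "qr_prime b P = 1" | "qr_prime a P = -1" "qr_prime b P = -1"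
    using qr_prime_cases[of a P] qr_prime_cases[of b P] by (auto simp: qr_prime_eq_0_iff)
  then show ?thesis
  proof cases
    case 1
    then have "qr_prime a P = 0" "qr_prime (a * b) P = 0" by (auto simp: qr_prime_eq_0_iff)
    then show ?thesis by simp
  next
    case 2
    then have "qr_prime b P = 0" "qr_prime (a * b) P = 0" by (auto simp: qr_prime_eq_0_iff)
    then show ?thesis by simp
  next
    case 3
    then show ?thesis using qr_prime_mult_square[OF P] by simp
  next
    case 4
    then show ?thesis using qr_prime_mult_square[OF P, of b a] by (simp add: mult.commute)
  next
    case 5
    have na: "\<not> P dvd a" using 5 by (auto simp: qr_prime_def)
    \<comment> \<open>\<open>?G\<close> is nonpositive everywhere and sums to 0, hence vanishes
      identically, which says (ah/P) = -(h/P). This replaces counting the two classes.\<close>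
    let ?G = "\<lambda>h. qr_prime (a * h) P + qr_prime h P"
    have le: "?G h \<le> 0" for h
    proof -
      consider "P dvd h" | "qr_prime h P = 1" | "qr_prime h P = -1"
        using qr_prime_cases[of h P] by (auto simp: qr_prime_eq_0_iff)
      then show ?thesis
      proof cases
        case 1
        then show ?thesis by (simp add: qr_prime_def)
      next
        case 2
        then have "qr_prime (h * a) P = qr_prime a P" by (rule qr_prime_mult_square[OF P])
        then show ?thesis using 2 5 by (simp add: mult.commute)
      next
        case 3
        then show ?thesis using qr_prime_cases[of "a * h" P] by auto
      qed
    qed
    have "(\<Sum>h\<in>deg_lt (degree P). ?G h) = (\<Sum>h\<in>deg_lt (degree P). qr_prime ((a * h) mod P) P) + (\<Sum>h\<in>deg_lt (degree P). qr_prime h P)"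
      by (simp add: sum.distrib qr_prime_cong[of "a * _ mod P" "a * _" P] cong_def)
    also have "\<dots> = 0" using sum_mult_mod[OF P na, of "\<lambda>h. qr_prime h P"] sum_qr_prime_eq_0[OF P] by simp
    finally have "(\<Sum>h\<in>deg_lt (degree P). - ?G h) = 0" by (simp only: sum_negf)
    then have "\<forall>h\<in>deg_lt (degree P). - ?G h = 0" using le
      by (subst (asm) sum_nonneg_eq_0_iff) (simp_all only: finite_deg_lt neg_0_le_iff_le)
    moreover obtain b' where b': "b' \<in> deg_lt (degree P)" "[b = b'] (mod P)" using ex_residue[of P b] by auto
    ultimately have "qr_prime (a * b') P + qr_prime b' P = 0" by auto
    moreover have "qr_prime (a * b') P = qr_prime (a * b) P"
      using b' by (intro qr_prime_cong cong_mult) (auto simp: cong_sym)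
    moreover have "qr_prime b' P = qr_prime b P" using b' by (intro qr_prime_cong) (auto simp: cong_sym)
    ultimately show ?thesis using 5 by simp
  qed
qed

lemma qr_prime_1 [simp]: "prime_elem (P :: 'a poly) \<Longrightarrow> qr_prime 1 P = 1"
  using qr_prime_square[of P 1] prime_elem_not_unit[of P] by simp

section \<open>The quadratic character of the constant field\<close>

text \<open>The symbol modulo T, restricted to constants, is the quadratic character of the field.\<close>
definition quad_char :: "'a \<Rightarrow> int" where
  "quad_char c = qr_prime [:c:] [:0, 1:]"

lemma quad_char_mult: "quad_char (b * c) = quad_char b * quad_char c"
  using qr_prime_mult[OF monic_irred_degD(2)[OF X_in_monic_irred], of "[:b:]" "[:c:]"]
  by (simp add: quad_char_def mult.commute)

lemma quad_char_0 [simp]: "quad_char 0 = 0"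
  by (simp add: quad_char_def qr_prime_def)

lemma quad_char_cases: "c \<noteq> 0 \<Longrightarrow> quad_char c = 1 \<or> quad_char c = -1"
  unfolding quad_char_def qr_prime_def by (auto dest!: dvd_imp_degree_le)

lemma quad_char_square: "c \<noteq> 0 \<Longrightarrow> quad_char (c\<^sup>2) = 1"
  using quad_char_cases[of c] by (auto simp: power2_eq_square quad_char_mult)

lemma quad_char_eq_1_iff: "quad_char c = 1 \<longleftrightarrow> c \<noteq> 0 \<and> (\<exists>x. x\<^sup>2 = c)"
proof
  assume c: "quad_char c = 1"
  then have "c \<noteq> 0" by auto
  from c obtain x where "[:0, 1:] dvd x\<^sup>2 - [:c:]"
    by (auto simp: quad_char_def qr_prime_def split: if_splits)
  then have "poly (x\<^sup>2 - [:c:]) 0 = 0" by (metis dvdE mult_zero_left poly_0 poly_mult poly_pCons add_0 mult_zero_left)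
  then have "(poly x 0)\<^sup>2 = c" by simp
  then show "c \<noteq> 0 \<and> (\<exists>x. x\<^sup>2 = c)" using \<open>c \<noteq> 0\<close> by blast
qed (auto simp: quad_char_square)

lemma sum_deg_lt_1: "(\<Sum>h\<in>deg_lt 1. F h) = (\<Sum>c\<in>UNIV. F [:c :: 'a:])"
  using sum_deg_lt_Suc[of F 0] by (simp add: monom_0)

lemma sum_quad_char: "(\<Sum>c\<in>UNIV. quad_char c) = 0"
  using sum_qr_prime_eq_0[OF monic_irred_degD(2)[OF X_in_monic_irred]] sum_deg_lt_1[of "\<lambda>h. qr_prime h [:0,1:]"]
  by (simp add: quad_char_def)

lemma ex_nonsquare: "\<exists>c. quad_char c = -1"
proof (rule ccontr)
  assume "\<not> ?thesis"
  then have "quad_char c \<ge> 0" for c using quad_char_cases[of c] by (cases "c = 0") auto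
  then have "quad_char 1 = 0" using sum_quad_char by (subst (asm) sum_nonneg_eq_0_iff) auto
  then show False using quad_char_cases[of 1] by auto
qed

lemma euler_field:
  assumes "c \<noteq> 0"
  shows "c ^ ((q - 1) div 2) = of_int (quad_char c)"
proof -
  let ?k = "(q - 1) div 2"
  have k: "2 * ?k = q - 1" using odd_q by simp
  have one: "x ^ (2 * ?k) = 1" if "x \<noteq> 0" for x :: 'a
  proof -
    have "x * x ^ (q - 1) = x" using fermat_field[of x] q_gt_2
      by (simp add: q_def flip: power_Suc)
    then show ?thesis using that k by simp
  qed
  have sq: "c ^ ?k = 1" if "quad_char c = 1" for c :: 'a
  proof -
    from that obtain x where "x\<^sup>2 = c" "c \<noteq> 0" by (auto simp: quad_char_eq_1_iff)
    then show ?thesis using one[of x] by (auto simp: power_mult)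
  qed
  show ?thesis
  proof (cases "quad_char c = 1")
    case False
    then have c: "quad_char c = -1" using assms quad_char_cases by blast
    have "(c ^ ?k)\<^sup>2 = 1" using one[OF assms] by (simp add: mult.commute flip: power_mult)
    then have "c ^ ?k = 1 \<or> c ^ ?k = -1" by (simp add: power2_eq_1_iff)
    moreover have "c ^ ?k \<noteq> 1"
    proof
      assume c1: "c ^ ?k = 1"
      \<comment> \<open>Products of two nonsquares are squares, so a single nonsquare c with c^k = 1
        would force b^k = 1 for all nonzero b, giving X^k - 1 a total of q - 1 = 2k roots.\<close>
      have all: "b ^ ?k = 1" if "b \<noteq> 0" for b :: 'a
      proof (cases "quad_char b = 1")
        case False
        then have "quad_char (b * c) = 1" using c that quad_char_cases[of b] by (simp add: quad_char_mult)
        then have "(b * c) ^ ?k = 1" by (rule sq)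
        then show ?thesis using c1 by (simp add: power_mult_distrib)
      qed (rule sq)
      let ?p = "monom 1 ?k - 1 :: 'a poly"
      have kpos: "?k > 0" using q_gt_2 odd_q by (auto elim!: oddE)
      then have "coeff ?p ?k \<noteq> 0" by simp
      then have nz: "?p \<noteq> 0" by (metis coeff_0)
      have "degree ?p \<le> ?k" by (intro degree_diff_le) (auto simp: degree_monom_le)
      moreover have "card (UNIV - {0 :: 'a}) \<le> card {x. poly ?p x = 0}"
        using nz all by (intro card_mono poly_roots_finite) (auto simp: poly_monom)
      moreover have "card {x. poly ?p x = 0} \<le> degree ?p" by (rule card_poly_roots_bound[OF nz])
      ultimately have "q - 1 \<le> ?k" by (simp add: q_def)
      then show False using k kpos by simp
    qed
    ultimately show ?thesis using c by simp
  next
    case True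
    then show ?thesis using sq[OF True] by simp
  qed
qed

end

section \<open>Quadratic sums and reciprocity\<close>

lemma residue_coeff_add: "residue_coeff f (x + y) = residue_coeff f x + residue_coeff f y"
  by (simp add: residue_coeff_def poly_mod_add_left)

lemma residue_coeff_smult: "residue_coeff f (smult c x) = c * residue_coeff f x"
  by (simp add: residue_coeff_def mod_smult_left)

lemma residue_coeff_cong: "[x = y] (mod f) \<Longrightarrow> residue_coeff f x = residue_coeff f y"
  by (simp add: residue_coeff_def cong_def)

lemma residue_coeff_low: "h \<in> deg_lt (degree f) \<Longrightarrow> residue_coeff f h = coeff h (degree f - 1)"
  by (simp add: residue_coeff_def mod_deg_lt_id)

lemma residue_coeff_eq_0:
  assumes "h \<in> deg_lt (degree f - 1)"
  shows "residue_coeff f h = 0"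
  using assms deg_lt_mono[of "degree f - 1" "degree f"] by (subst residue_coeff_low) (auto simp: deg_lt_def)

text \<open>The products have degree at most \<open>degree f - 2\<close>. Together with
  \<open>residue_coeff_nondegenerate\<close> this makes \<open>deg_lt k\<close> and
  \<open>deg_lt (degree f - k)\<close> exact orthogonal complements for the pairing (y, z) ->
  \<open>residue_coeff f (y * z)\<close>.\<close>

lemma residue_coeff_orthogonal:
  assumes "k \<le> degree f" "degree f > 0" "z \<in> deg_lt (degree f - k)" "y \<in> deg_lt k"
  shows "residue_coeff f (y * z) = 0"
  by (rule residue_coeff_eq_0, rule deg_lt_mult[OF assms(4,3)]) (use assms in auto)

text \<open>The power of T that lifts z to degree \<open>degree f - 1\<close> moves its leading
  coefficient to the position that is read; the lower bound on the degree of z keeps this power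
  below T^k.\<close>

lemma residue_coeff_nondegenerate:
  assumes "k \<le> degree f" "z \<in> deg_lt (degree f)" "z \<notin> deg_lt (degree f - k)"
  shows "\<exists>y\<in>deg_lt k. residue_coeff f (y * z) \<noteq> 0"
proof -
  let ?n = "degree f" and ?e = "degree z"
  have z: "z \<noteq> 0" "?e < ?n" "?n - k \<le> ?e" using assms by (auto simp: mem_deg_lt_iff)
  let ?y = "monom 1 (?n - 1 - ?e)"
  have y: "?y \<in> deg_lt k" using z assms(1) by (intro deg_lt_monom) auto
  have "z \<in> deg_lt (Suc ?e)" by (simp add: deg_lt_degree_le)
  moreover have "?y \<in> deg_lt (?n - ?e)" using z by (intro deg_lt_monom) auto
  ultimately have "?y * z \<in> deg_lt ?n" using z by (intro deg_lt_mult) auto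
  then have "residue_coeff f (?y * z) = coeff z ?e"
    using z by (simp add: residue_coeff_low coeff_monom_mult)
  then show ?thesis using y z by (intro bexI[of _ ?y]) auto
qed

lemma coeff_square_top:
  assumes "x \<in> deg_lt (Suc k)"
  shows "coeff (x\<^sup>2) (2 * k) = (coeff x k)\<^sup>2"
proof -
  have "coeff (x\<^sup>2) (2 * k) = (\<Sum>i\<le>2 * k. coeff x i * coeff x (2 * k - i))"
    by (simp add: power2_eq_square coeff_mult)
  also have "\<dots> = (\<Sum>i\<in>{k}. coeff x i * coeff x (2 * k - i))"
  proof (rule sum.mono_neutral_right)
    show "\<forall>i\<in>{..2 * k} - {k}. coeff x i * coeff x (2 * k - i) = 0"
    proof
      fix i assume "i \<in> {..2 * k} - {k}"
      then have "i \<ge> Suc k \<or> 2 * k - i \<ge> Suc k" by auto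
      then show "coeff x i * coeff x (2 * k - i) = 0" using assms by (auto simp: deg_lt_def)
    qed
  qed auto
  finally show ?thesis by (simp add: power2_eq_square mult_2)
qed

lemma sum_affine:
  fixes w :: "'a::{finite,field_gcd} \<Rightarrow> real"
  assumes "b \<noteq> 0"
  shows "(\<Sum>c\<in>UNIV. w (s + c * b)) = (\<Sum>t\<in>UNIV. w t)"
  by (rule sum.reindex_bij_witness[where i = "\<lambda>t. (t - s) / b" and j = "\<lambda>c. s + c * b"]) (use assms in auto)

lemma sum_deg_lt_translate:
  fixes F :: "'a::{finite,field_gcd} poly \<Rightarrow> 'b::comm_monoid_add"
  assumes "y \<in> deg_lt n"
  shows "(\<Sum>x\<in>deg_lt n. F (x + y)) = (\<Sum>x\<in>deg_lt n. F x)"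
  by (rule sum.reindex_bij_witness[where i = "\<lambda>x. x - y" and j = "\<lambda>x. x + y"]) (use assms in \<open>auto intro: deg_lt_add deg_lt_diff\<close>)

lemma sum_over_linear_form:
  fixes w :: "'a::{finite,field_gcd} \<Rightarrow> real" and \<phi> :: "'a poly \<Rightarrow> 'a"
  assumes add: "\<And>x y. \<phi> (x + y) = \<phi> x + \<phi> y" and smult: "\<And>c x. \<phi> (smult c x) = c * \<phi> x"
    and y0: "y0 \<in> deg_lt k" "\<phi> y0 \<noteq> 0" and w: "(\<Sum>t\<in>UNIV. w t) = 0"
  shows "(\<Sum>y\<in>deg_lt k. w (s + \<phi> y)) = 0"
proof -
  \<comment> \<open>After averaging over translation by multiples of y0, \<open>\<phi>\<close> runs
    through the whole field on each line in direction y0, so every line contributes the total mass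
    of w.\<close>
  have "(\<Sum>c\<in>(UNIV :: 'a set). \<Sum>y\<in>deg_lt k. w (s + \<phi> y)) = (\<Sum>c\<in>UNIV. \<Sum>y\<in>deg_lt k. w (s + \<phi> (y + smult c y0)))"
    by (intro sum.cong refl sum_deg_lt_translate[symmetric] deg_lt_smult y0)
  also have "\<dots> = (\<Sum>y\<in>deg_lt k. \<Sum>c\<in>UNIV. w (s + \<phi> (y + smult c y0)))" by (rule sum.swap)
  also have "\<dots> = (\<Sum>y\<in>deg_lt k. \<Sum>c\<in>UNIV. w ((s + \<phi> y) + c * \<phi> y0))" by (simp add: add smult add.assoc)
  also have "\<dots> = 0" using y0 w by (simp add: sum_affine)
  finally show ?thesis using finite_UNIV_card_ge_0[where ?'a='a] by simp
qed

text \<open>P h / (P Q) and h / Q are the same fraction. As \<open>residue_coeff\<close> reads a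
  coefficient of the remainder instead of the fraction, the leading coefficient of P enters and has
  to be 1.\<close>

lemma residue_coeff_mult_left:
  assumes "lead_coeff P = 1" "degree Q > 0"
  shows "residue_coeff (P * Q) (P * h) = residue_coeff Q h"
proof -
  have nz: "P \<noteq> 0" "Q \<noteq> 0" using assms by auto
  have "(P * h) mod (P * Q) = P * (h mod Q)" by (rule mult_mod_right[symmetric])
  moreover have "coeff (P * r) (degree P + degree Q - 1) = coeff r (degree Q - 1)"
    if "r \<in> deg_lt (degree Q)" for r
  proof (cases "degree r = degree Q - 1")
    case True
    have "coeff (P * r) (degree P + degree r) = lead_coeff P * lead_coeff r" by (rule coeff_mult_degree_sum)
    then show ?thesis using True assms by (simp add: Nat.add_diff_assoc)
  next
    case False
    then have "r = 0 \<or> degree r < degree Q - 1" using that assms by (auto simp: mem_deg_lt_iff)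
    then show ?thesis using nz by (cases "r = 0") (auto simp: coeff_eq_0 degree_mult_eq)
  qed
  ultimately show ?thesis
    using nz mod_in_deg_lt[of Q h] by (simp add: residue_coeff_def degree_mult_eq)
qed

lemma monic_irred_dvd_eq:
  fixes P Q :: "'a::field_gcd poly"
  assumes "P \<in> monic_irred_deg m" "Q \<in> monic_irred_deg n" "P dvd Q"
  shows "P = Q"
proof -
  obtain c where c: "Q = P * c" using assms(3) by blast
  then have "is_unit c" using monic_irred_degD(1)[OF assms(2)] monic_irred_degD(1)[OF assms(1)]
    by (metis irreducibleD irreducible_not_unit)
  then obtain a where a: "c = [:a:]" by (auto simp: is_unit_poly_iff)
  have "lead_coeff Q = lead_coeff P * a" by (simp add: c a lead_coeff_mult)
  then have "a = 1" using monic_irred_degD(4) assms by (metis mult_1)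
  then show ?thesis using c a by simp
qed

section \<open>Quadratic sums and Gauss sums with a general weight\<close>

context odd_field
begin

text \<open>The polynomials of degree less than k form a totally isotropic subspace for the quadratic form sending x
  to the residue coefficient of x^2; averaging over its translates kills everything outside its orthogonal
  complement.\<close>
lemma quadratic_sum_isotropic:
  fixes f :: "'a poly" and w :: "'a \<Rightarrow> real"
  assumes n: "degree f > 0" "2 * k \<le> degree f" and w: "(\<Sum>t\<in>UNIV. w t) = 0"
  shows "(\<Sum>x\<in>deg_lt (degree f). w (residue_coeff f (x\<^sup>2))) = (\<Sum>x\<in>deg_lt (degree f - k). w (residue_coeff f (x\<^sup>2)))"
proof -
  let ?n = "degree f" and ?r = "residue_coeff f"
  have kn: "deg_lt k \<subseteq> (deg_lt ?n :: 'a poly set)" using n by (intro deg_lt_mono) auto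
  have expand: "?r ((x + y)\<^sup>2) = ?r (x\<^sup>2) + ?r (y * (2 * x))" if "y \<in> deg_lt k" for x y
  proof -
    \<comment> \<open>Isotropy: 2k <= degree f gives y^2 degree at most degree f - 2, just below the
      position that is read.\<close>
    have "y * y \<in> deg_lt (?n - 1)" using that n by (intro deg_lt_mult[of _ k _ k]) auto
    then have "?r (y * y) = 0" by (rule residue_coeff_eq_0)
    moreover have "(x + y)\<^sup>2 = x\<^sup>2 + y * (2 * x) + y * y" by (simp add: power2_eq_square algebra_simps)
    ultimately show ?thesis by (simp add: residue_coeff_add)
  qed
  have inner: "(\<Sum>y\<in>deg_lt k. w (?r (x\<^sup>2) + ?r (y * (2 * x)))) = (if x \<in> deg_lt (?n - k) then real q ^ k * w (?r (x\<^sup>2)) else 0)"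
    if x: "x \<in> deg_lt ?n" for x
  proof -
    have two: "(2 :: 'a poly) * x = smult 2 x" by (simp add: numeral_poly)
    have mem: "2 * x \<in> deg_lt m \<longleftrightarrow> x \<in> deg_lt m" for m
      unfolding two using two_neq_0 by (simp add: deg_lt_def)
    show ?thesis
    proof (cases "x \<in> deg_lt (?n - k)")
      case True
      then have "?r (y * (2 * x)) = 0" if "y \<in> deg_lt k" for y
        using n that mem by (intro residue_coeff_orthogonal[of k]) auto
      then show ?thesis using True by (simp add: card_deg_lt_q)
    next
      case False
      then obtain y0 where "y0 \<in> deg_lt k" "?r (y0 * (2 * x)) \<noteq> 0"
        using residue_coeff_nondegenerate[of k f "2 * x"] n x mem by auto
      then have "(\<Sum>y\<in>deg_lt k. w (?r (x\<^sup>2) + ?r (y * (2 * x)))) = 0"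
        by (intro sum_over_linear_form[OF _ _ _ _ w]) (auto simp: distrib_right residue_coeff_add residue_coeff_smult)
      then show ?thesis using False by simp
    qed
  qed
  have "(\<Sum>y\<in>(deg_lt k :: 'a poly set). \<Sum>x\<in>deg_lt ?n. w (?r (x\<^sup>2))) = (\<Sum>y\<in>deg_lt k. \<Sum>x\<in>deg_lt ?n. w (?r ((x + y)\<^sup>2)))"
    by (intro sum.cong refl sum_deg_lt_translate[symmetric, where F = "\<lambda>x. w (?r (x\<^sup>2))"]) (use kn in auto)
  also have "\<dots> = (\<Sum>x\<in>deg_lt ?n. \<Sum>y\<in>deg_lt k. w (?r ((x + y)\<^sup>2)))" by (rule sum.swap)
  also have "\<dots> = (\<Sum>x\<in>deg_lt ?n. if x \<in> deg_lt (?n - k) then real q ^ k * w (?r (x\<^sup>2)) else 0)"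
    by (intro sum.cong refl) (simp add: expand inner)
  also have "\<dots> = (\<Sum>x\<in>deg_lt ?n \<inter> deg_lt (?n - k). real q ^ k * w (?r (x\<^sup>2)))"
    by (simp add: sum.inter_restrict)
  also have "deg_lt ?n \<inter> deg_lt (?n - k) = (deg_lt (?n - k) :: 'a poly set)" using deg_lt_mono[of "?n - k" ?n] by auto
  finally show ?thesis using q_gt_2 by (simp add: card_deg_lt_q flip: sum_distrib_left)
qed

text \<open>The averaging leaves x of degree at most k, whose squares have degree at most 2k =
  degree f - 1, so the form sees only the square of the coefficient of T^k.\<close>

lemma quadratic_sum_odd:
  fixes f :: "'a poly" and w :: "'a \<Rightarrow> real"
  assumes n: "degree f = 2 * k + 1" and w: "(\<Sum>t\<in>UNIV. w t) = 0"
  shows "(\<Sum>x\<in>deg_lt (degree f). w (residue_coeff f (x\<^sup>2))) = real q ^ k * (\<Sum>c\<in>UNIV. w (c\<^sup>2))"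
proof -
  have "residue_coeff f (x\<^sup>2) = (coeff x k)\<^sup>2" if "x \<in> deg_lt (Suc k)" for x
  proof -
    have "x\<^sup>2 \<in> deg_lt (degree f)" unfolding power2_eq_square using that n by (intro deg_lt_mult[of _ "Suc k" _ "Suc k"]) auto
    then have "residue_coeff f (x\<^sup>2) = coeff (x\<^sup>2) (2 * k)" using n by (simp add: residue_coeff_low)
    then show ?thesis using coeff_square_top[OF that] by simp
  qed
  then have "(\<Sum>x\<in>deg_lt (Suc k). w (residue_coeff f (x\<^sup>2))) = (\<Sum>x\<in>deg_lt (Suc k). w ((coeff x k)\<^sup>2))" by simp
  also have "\<dots> = (\<Sum>c\<in>UNIV. \<Sum>y\<in>deg_lt k. w ((coeff (monom c k + y) k)\<^sup>2))" by (rule sum_deg_lt_Suc)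
  also have "\<dots> = (\<Sum>c\<in>UNIV. \<Sum>y\<in>(deg_lt k :: 'a poly set). w (c\<^sup>2))"
    by (intro sum.cong refl) (simp add: deg_lt_def)
  also have "\<dots> = real q ^ k * (\<Sum>c\<in>UNIV. w (c\<^sup>2))" by (simp add: card_deg_lt_q sum_distrib_left)
  finally show ?thesis using quadratic_sum_isotropic[of f k w] n w by simp
qed

text \<open>Here \<open>deg_lt k\<close> is its own orthogonal complement, and the form vanishes on
  it.\<close>

lemma quadratic_sum_even:
  fixes f :: "'a poly" and w :: "'a \<Rightarrow> real"
  assumes n: "degree f = 2 * k" "k > 0" and w: "(\<Sum>t\<in>UNIV. w t) = 0"
  shows "(\<Sum>x\<in>deg_lt (degree f). w (residue_coeff f (x\<^sup>2))) = real q ^ k * w 0"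
proof -
  have "residue_coeff f (x\<^sup>2) = 0" if "x \<in> deg_lt k" for x
    unfolding power2_eq_square using that n by (intro residue_coeff_eq_0 deg_lt_mult[of _ k _ k]) auto
  then have "(\<Sum>x\<in>deg_lt k. w (residue_coeff f (x\<^sup>2))) = real q ^ k * w 0" by (simp add: card_deg_lt_q)
  then show ?thesis using quadratic_sum_isotropic[of f k w] n w by simp
qed

text \<open>Grouping x by x^2 gives the weight 1 + (h/P); the 1 drops out because h ->
  \<open>residue_coeff P (a * h)\<close> is a nonzero linear form and w has total mass 0. The right
  side is the analogue of a Gauss sum.\<close>

lemma twisted_sum:
  fixes P a :: "'a poly" and w :: "'a \<Rightarrow> real"
  assumes P: "prime_elem P" "degree P > 0" and a: "\<not> P dvd a" and w: "(\<Sum>t\<in>UNIV. w t) = 0"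
  shows "(\<Sum>x\<in>deg_lt (degree P). w (residue_coeff P (a * x\<^sup>2))) =
    (\<Sum>h\<in>deg_lt (degree P). real_of_int (qr_prime h P) * w (residue_coeff P (a * h)))"
proof -
  let ?n = "degree P" and ?r = "residue_coeff P"
  have [simp]: "P \<noteq> 0" using P by auto
  \<comment> \<open>Solving a y0 = T^(degree P - 1) modulo P exhibits the value 1 of the linear
    form.\<close>
  have "monom 1 (?n - 1) \<in> (deg_lt ?n :: 'a poly set)" using P by (intro deg_lt_monom) auto
  then have "monom 1 (?n - 1) \<in> (\<lambda>x. (a * x) mod P) ` deg_lt ?n"
    using bij_betw_mult_mod[OF P(1) a] by (simp add: bij_betw_def)
  then obtain y0 where y0: "y0 \<in> deg_lt ?n" "(a * y0) mod P = monom 1 (?n - 1)" by auto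
  then have "?r (a * y0) \<noteq> 0" by (simp add: residue_coeff_def)
  then have zero: "(\<Sum>h\<in>deg_lt ?n. w (?r (a * h))) = 0"
    using sum_over_linear_form[of "\<lambda>h. ?r (a * h)" y0 ?n w 0] y0 w
    by (simp add: distrib_left residue_coeff_add residue_coeff_smult)
  have "(\<Sum>x\<in>deg_lt ?n. w (?r (a * x\<^sup>2))) = (\<Sum>x\<in>deg_lt ?n. w (?r (a * (x\<^sup>2 mod P))))"
    by (intro sum.cong refl arg_cong[of _ _ w] residue_coeff_cong cong_mult) (auto simp: cong_def)
  also have "\<dots> = (\<Sum>h\<in>deg_lt ?n. (1 + real_of_int (qr_prime h P)) * w (?r (a * h)))"
    by (rule sum_qr_prime_group[OF P(1), of "\<lambda>h. w (?r (a * h))"])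
  finally show ?thesis using zero by (simp add: distrib_right sum.distrib)
qed

lemma qr_prime_square_eq_1:
  assumes "\<not> P dvd a"
  shows "qr_prime a P * qr_prime a P = 1"
  using assms by (simp add: qr_prime_def)

text \<open>Substitute a h for h, as for Gauss sums; (a/P) is its own inverse.\<close>

lemma character_sum_twist:
  fixes P a :: "'a poly" and w :: "'a \<Rightarrow> real"
  assumes P: "prime_elem P" and a: "\<not> P dvd a"
  shows "(\<Sum>h\<in>deg_lt (degree P). real_of_int (qr_prime h P) * w (residue_coeff P (a * h))) =
    qr_prime a P * (\<Sum>h\<in>deg_lt (degree P). real_of_int (qr_prime h P) * w (residue_coeff P h))"
proof -
  let ?F = "\<lambda>h. real_of_int (qr_prime h P) * w (residue_coeff P h)"
  have "(\<Sum>h\<in>deg_lt (degree P). ?F h) = (\<Sum>h\<in>deg_lt (degree P). ?F ((a * h) mod P))"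
    by (rule sum_mult_mod[OF assms, symmetric])
  also have "\<dots> = (\<Sum>h\<in>deg_lt (degree P). ?F (a * h))"
    by (intro sum.cong refl arg_cong2[of _ _ _ _ "(*)"] arg_cong[of _ _ w] arg_cong[of _ _ real_of_int]
          residue_coeff_cong qr_prime_cong) (auto simp: cong_def)
  also have "\<dots> = qr_prime a P * (\<Sum>h\<in>deg_lt (degree P). real_of_int (qr_prime h P) * w (residue_coeff P (a * h)))"
    by (simp add: qr_prime_mult[OF P] sum_distrib_left mult.assoc)
  finally show ?thesis
    using qr_prime_square_eq_1[OF a] by (simp flip: mult.assoc of_int_mult)
qed

lemma quadratic_sum_twist:
  fixes P a :: "'a poly" and w :: "'a \<Rightarrow> real"
  assumes P: "prime_elem P" "degree P > 0" and a: "\<not> P dvd a" and w: "(\<Sum>t\<in>UNIV. w t) = 0"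
  shows "(\<Sum>x\<in>deg_lt (degree P). w (residue_coeff P (a * x\<^sup>2))) =
    qr_prime a P * (\<Sum>x\<in>deg_lt (degree P). w (residue_coeff P (x\<^sup>2)))"
proof -
  have "\<not> P dvd 1" using P prime_elem_not_unit by blast
  then show ?thesis
    using twisted_sum[OF P a w] twisted_sum[OF P _ w, of 1] character_sum_twist[OF P(1) a, of w] by simp
qed

section \<open>Chinese remainder splitting and the reciprocity law\<close>

lemma bij_betw_crt:
  fixes P Q :: "'a poly"
  assumes P: "prime_elem P" and Q: "prime_elem Q" and PQ: "\<not> P dvd Q" "\<not> Q dvd P" "degree P > 0" "degree Q > 0"
  shows "bij_betw (\<lambda>(x, y). P * x + Q * y) (deg_lt (degree Q) \<times> deg_lt (degree P)) (deg_lt (degree (P * Q)))"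
  unfolding bij_betw_def
proof
  have nz: "P \<noteq> 0" "Q \<noteq> 0" using P Q by auto
  show inj: "inj_on (\<lambda>(x, y). P * x + Q * y) (deg_lt (degree Q) \<times> deg_lt (degree P))"
  proof (rule inj_onI, clarify)
    fix x y x' y' :: "'a poly"
    assume *: "x \<in> deg_lt (degree Q)" "y \<in> deg_lt (degree P)" "x' \<in> deg_lt (degree Q)" "y' \<in> deg_lt (degree P)"
      and eq: "P * x + Q * y = P * x' + Q * y'"
    have eq': "P * (x - x') = Q * (y' - y)" using eq by (simp add: algebra_simps)
    then have "Q dvd P * (x - x')" by simp
    then have "Q dvd x - x'" using Q PQ by (simp add: prime_elem_dvd_mult_iff)
    then have x: "x = x'" using * deg_lt_diff not_dvd_deg_lt by (metis eq_iff_diff_eq_0)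
    then have "y = y'" using eq nz by simp
    with x show "x = x' \<and> y = y'" by simp
  qed
  show "(\<lambda>(x, y). P * x + Q * y) ` (deg_lt (degree Q) \<times> deg_lt (degree P)) = deg_lt (degree (P * Q))"
  proof (rule card_subset_eq)
    show "(\<lambda>(x, y). P * x + Q * y) ` (deg_lt (degree Q) \<times> deg_lt (degree P)) \<subseteq> deg_lt (degree (P * Q))"
    proof (clarify, rule deg_lt_add)
      fix x y :: "'a poly" assume xy: "x \<in> deg_lt (degree Q)" "y \<in> deg_lt (degree P)"
      have "P \<in> deg_lt (Suc (degree P))" "Q \<in> deg_lt (Suc (degree Q))" by (simp_all add: deg_lt_degree_le)
      then show "P * x \<in> deg_lt (degree (P * Q))" "Q * y \<in> deg_lt (degree (P * Q))"
        using xy by (auto intro!: deg_lt_mult simp: degree_mult_eq nz)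
    qed
    show "card ((\<lambda>(x, y). P * x + Q * y) ` (deg_lt (degree Q) \<times> deg_lt (degree P))) = card (deg_lt (degree (P * Q)) :: 'a poly set)"
      using inj by (simp add: card_image card_cartesian_product card_deg_lt_q degree_mult_eq nz power_add)
  qed simp
qed

text \<open>Divide (P x + Q y)^2 by P Q: the result is P x^2 / Q + Q y^2 / P + 2 x y, and the last
  term is a polynomial, so it has no coefficient of 1/T.\<close>

lemma quadratic_sum_crt:
  fixes P Q :: "'a poly" and w :: "'a \<Rightarrow> real"
  assumes P: "prime_elem P" "lead_coeff P = 1" "degree P > 0"
    and Q: "prime_elem Q" "lead_coeff Q = 1" "degree Q > 0" and PQ: "\<not> P dvd Q" "\<not> Q dvd P"
  shows "(\<Sum>x\<in>deg_lt (degree (P * Q)). w (residue_coeff (P * Q) (x\<^sup>2))) =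
    (\<Sum>x\<in>deg_lt (degree Q). \<Sum>y\<in>deg_lt (degree P). w (residue_coeff Q (P * x\<^sup>2) + residue_coeff P (Q * y\<^sup>2)))"
proof -
  have key: "residue_coeff (P * Q) ((P * x + Q * y)\<^sup>2) = residue_coeff Q (P * x\<^sup>2) + residue_coeff P (Q * y\<^sup>2)" for x y
  proof -
    have "(P * x + Q * y)\<^sup>2 = P * (P * x\<^sup>2) + (Q * (Q * y\<^sup>2) + P * Q * (2 * x * y))"
      by (simp add: power2_eq_square algebra_simps)
    moreover have "residue_coeff (P * Q) (P * Q * (2 * x * y)) = 0"
      by (simp add: residue_coeff_def del: mult_2)
    moreover have "residue_coeff (P * Q) (P * (P * x\<^sup>2)) = residue_coeff Q (P * x\<^sup>2)"
      by (rule residue_coeff_mult_left) (use P Q in auto)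
    moreover have "residue_coeff (P * Q) (Q * (Q * y\<^sup>2)) = residue_coeff P (Q * y\<^sup>2)"
      using residue_coeff_mult_left[of Q P "Q * y\<^sup>2"] P Q by (simp add: mult.commute)
    ultimately show ?thesis by (simp only: residue_coeff_add add_0_right)
  qed
  have "(\<Sum>x\<in>deg_lt (degree (P * Q)). w (residue_coeff (P * Q) (x\<^sup>2))) =
    (\<Sum>z\<in>deg_lt (degree Q) \<times> deg_lt (degree P). w (residue_coeff (P * Q) ((case z of (x, y) \<Rightarrow> P * x + Q * y)\<^sup>2)))"
    by (rule sum.reindex_bij_betw[OF bij_betw_crt, symmetric]) (use P Q PQ in auto)
  also have "\<dots> = (\<Sum>(x, y)\<in>deg_lt (degree Q) \<times> deg_lt (degree P). w (residue_coeff Q (P * x\<^sup>2) + residue_coeff P (Q * y\<^sup>2)))"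
    by (intro sum.cong refl) (auto simp: key)
  finally show ?thesis by (simp add: sum.cartesian_product)
qed

lemma sum_shift: "(\<Sum>t\<in>UNIV. w (s + t)) = (\<Sum>t\<in>UNIV. w t)" for w :: "'a \<Rightarrow> real"
  using sum_affine[of 1 w s] by simp

text \<open>Summing out the variable modulo P replaces w by t -> sum of w(t + c^2) over c. This new
  weight again has total mass 0, so the same evaluations apply to it modulo Q.\<close>

lemma sum_shift_squares:
  fixes w :: "'a \<Rightarrow> real"
  assumes "(\<Sum>t\<in>UNIV. w t) = 0"
  shows "(\<Sum>s\<in>UNIV. \<Sum>c\<in>UNIV. w (s + c\<^sup>2)) = 0"
proof -
  have "(\<Sum>s\<in>UNIV. \<Sum>c\<in>UNIV. w (s + c\<^sup>2)) = (\<Sum>c\<in>UNIV. \<Sum>s\<in>UNIV. w (c\<^sup>2 + s))"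
    by (subst sum.swap) (simp add: add.commute)
  then show ?thesis using assms by (simp add: sum_shift)
qed

lemma quadratic_sum_product:
  fixes P Q :: "'a poly" and w :: "'a \<Rightarrow> real"
  assumes P: "prime_elem P" "lead_coeff P = 1" "degree P = 2 * g + 1"
    and Q: "prime_elem Q" "lead_coeff Q = 1" "degree Q > 0" and PQ: "\<not> P dvd Q" "\<not> Q dvd P"
    and w: "(\<Sum>t\<in>UNIV. w t) = 0"
  shows "(\<Sum>x\<in>deg_lt (degree (P * Q)). w (residue_coeff (P * Q) (x\<^sup>2))) =
    qr_prime P Q * qr_prime Q P * real q ^ g * (\<Sum>x\<in>deg_lt (degree Q). \<Sum>c\<in>UNIV. w (residue_coeff Q (x\<^sup>2) + c\<^sup>2))"
proof -
  let ?w = "\<lambda>s. \<Sum>c\<in>UNIV. w (s + c\<^sup>2)"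
  have w': "(\<Sum>s\<in>UNIV. ?w s) = 0" by (rule sum_shift_squares[OF w])
  have "(\<Sum>y\<in>deg_lt (degree P). w (s + residue_coeff P (Q * y\<^sup>2))) = qr_prime Q P * real q ^ g * ?w s" for s
    using quadratic_sum_twist[of P Q "\<lambda>t. w (s + t)"] quadratic_sum_odd[of P g "\<lambda>t. w (s + t)"] P PQ w
    by (simp add: sum_shift)
  then have "(\<Sum>x\<in>deg_lt (degree (P * Q)). w (residue_coeff (P * Q) (x\<^sup>2))) =
      qr_prime Q P * real q ^ g * (\<Sum>x\<in>deg_lt (degree Q). ?w (residue_coeff Q (P * x\<^sup>2)))"
    using quadratic_sum_crt[of P Q w] P Q PQ by (simp add: sum_distrib_left)
  also have "(\<Sum>x\<in>deg_lt (degree Q). ?w (residue_coeff Q (P * x\<^sup>2))) = qr_prime P Q * (\<Sum>x\<in>deg_lt (degree Q). ?w (residue_coeff Q (x\<^sup>2)))"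
    by (rule quadratic_sum_twist) (use Q PQ w' in auto)
  finally show ?thesis by simp
qed

lemma sum_quad_char_square: "(\<Sum>c\<in>UNIV. real_of_int (quad_char (c\<^sup>2))) = real q - 1"
proof -
  have "(\<Sum>c\<in>UNIV. real_of_int (quad_char (c\<^sup>2))) = (\<Sum>c\<in>UNIV - {0}. real_of_int (quad_char (c\<^sup>2)))"
    by (subst sum.remove[of _ 0]) auto
  also have "\<dots> = (\<Sum>c\<in>UNIV - {0 :: 'a}. 1)" by (intro sum.cong) (auto simp: quad_char_square)
  finally show ?thesis using q_gt_2 by (simp add: q_def of_nat_diff)
qed

lemma minus_one_square:
  assumes "q mod 4 = 1"
  shows "\<exists>i :: 'a. i\<^sup>2 = -1"
proof -
  obtain k where "q = 4 * k + 1" using assms by (metis mod_eqE mod_mult_div_eq mult.commute add.commute)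
  then have k: "(q - 1) div 2 = 2 * k" by simp
  have "of_int (quad_char (-1)) = (-1 :: 'a) ^ (2 * k)" using euler_field[of "-1"] unfolding k by simp
  then have "of_int (quad_char (-1)) = (1 :: 'a)" by simp
  then have "quad_char (-1) \<noteq> -1" using eq_uminus_iff[of 1] by auto
  then have "quad_char (-1) = 1" using quad_char_cases[of "-1"] by auto
  then show ?thesis by (simp add: quad_char_eq_1_iff)
qed

text \<open>The quadratic sum modulo P Q is evaluated directly, where only the degree matters, and
  through the splitting, which carries the factor (P/Q)(Q/P). With a weight for which both
  evaluations are positive, this factor is positive, hence 1.\<close>

theorem quadratic_reciprocity:
  fixes P Q :: "'a poly"
  assumes q4: "q mod 4 = 1" and P: "P \<in> monic_irred_deg (2 * g + 1)" and Q: "Q \<in> monic_irred_deg n"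
  shows "qr_prime P Q = qr_prime Q P"
proof (cases "P = Q")
  case False
  note PD = monic_irred_degD[OF P] and QD = monic_irred_degD[OF Q]
  have nd: "\<not> P dvd Q" "\<not> Q dvd P" using monic_irred_dvd_eq[OF P Q] monic_irred_dvd_eq[OF Q P] False by auto
  have deg: "degree (P * Q) = 2 * g + 1 + n" using PD QD by (simp add: degree_mult_eq)
  let ?e = "real_of_int (qr_prime P Q) * real_of_int (qr_prime Q P)"
  note prod = quadratic_sum_product[OF PD(2,4,3) QD(2,4) _ nd]
  have pos: "?e > 0"
  proof (cases "even n")
    case True
    then obtain l where l: "n = 2 * l" by (auto elim: evenE)
    \<comment> \<open>The degree of P Q is odd, so the direct evaluation sees w only at squares; the
      quadratic character is 1 at nonzero squares, and the new weight at 0 is the same value q -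
      1.\<close>
    let ?w = "\<lambda>t. real_of_int (quad_char t)"
    have w: "(\<Sum>t\<in>UNIV. ?w t) = 0" using sum_quad_char by (metis of_int_0 of_int_sum)
    have w': "(\<Sum>t\<in>UNIV. \<Sum>c\<in>UNIV. ?w (t + c\<^sup>2)) = 0"
      by (rule sum_shift_squares[OF w])
    have "(\<Sum>x\<in>deg_lt (degree (P * Q)). ?w (residue_coeff (P * Q) (x\<^sup>2))) = real q ^ (g + l) * (real q - 1)"
      using quadratic_sum_odd[OF _ w, of "P * Q" "g + l"] deg l by (simp add: sum_quad_char_square)
    moreover have "(\<Sum>x\<in>deg_lt (degree Q). \<Sum>c\<in>UNIV. ?w (residue_coeff Q (x\<^sup>2) + c\<^sup>2)) = real q ^ l * (real q - 1)"
      using quadratic_sum_even[OF _ _ w', of Q l] QD l by (simp add: sum_quad_char_square)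
    ultimately have "real q ^ (g + l) * (real q - 1) = ?e * (real q ^ g * (real q ^ l * (real q - 1)))"
      using prod[OF _ w] QD by (simp only: mult.assoc of_int_mult)
    moreover have "real q ^ (g + l) * (real q - 1) > 0" "real q ^ g * (real q ^ l * (real q - 1)) > 0"
      using q_gt_2 by auto
    ultimately show ?thesis by (metis zero_less_mult_pos2)
  next
    case False
    then obtain l where l: "n = 2 * l + 1" by (auto elim: oddE)
    \<comment> \<open>The degree of P Q is even and only w(0) survives; q times the indicator of 0
      is shifted to have total mass 0.\<close>
    let ?w = "\<lambda>t :: 'a. real q * of_bool (t = 0) - 1"
    have w: "(\<Sum>t\<in>UNIV. ?w t) = 0"
      by (simp add: sum_subtractf q_def of_bool_def if_distrib[of "\<lambda>x. _ * x"] cong: if_cong)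
    have w': "(\<Sum>t\<in>UNIV. \<Sum>c\<in>UNIV. ?w (t + c\<^sup>2)) = 0"
      by (rule sum_shift_squares[OF w])
    obtain i :: 'a where i: "i\<^sup>2 = -1" using minus_one_square[OF q4] by blast
    have i0: "i \<noteq> 0" using i by auto
    \<comment> \<open>Here q = 1 mod 4 enters: for nonzero b, both i b and - i b solve b^2 + c^2 =
      0, while b = 0 has the solution c = 0. The sum is q times the number of solutions minus
      q.\<close>
    have inner: "(\<Sum>c\<in>UNIV. ?w (b\<^sup>2 + c\<^sup>2)) \<ge> (if b = 0 then 0 else real q)" for b
    proof -
      have "(\<Sum>c\<in>UNIV. ?w (b\<^sup>2 + c\<^sup>2)) = real q * real (card {c. b\<^sup>2 + c\<^sup>2 = 0}) - real q"
        by (simp add: sum_subtractf q_def flip: sum_distrib_left)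
      moreover have "card {c. b\<^sup>2 + c\<^sup>2 = 0} \<ge> (if b = 0 then 1 else 2)"
      proof -
        have "card {i * b, - (i * b)} \<le> card {c. b\<^sup>2 + c\<^sup>2 = 0}"
          by (intro card_mono) (auto simp: power_mult_distrib i)
        moreover have "i * b \<noteq> - (i * b)" if "b \<noteq> 0" using that i0 eq_uminus_iff[of "i * b"] by simp
        ultimately show ?thesis by (auto split: if_splits)
      qed
      then have "real q * real (card {c. b\<^sup>2 + c\<^sup>2 = 0}) \<ge> real q * (if b = 0 then 1 else 2)"
        by (intro mult_left_mono) (auto split: if_splits)
      ultimately show ?thesis by (auto split: if_splits)
    qed
    have "(\<Sum>b\<in>UNIV. \<Sum>c\<in>UNIV. ?w (b\<^sup>2 + c\<^sup>2)) \<ge> (\<Sum>b\<in>UNIV. if b = (0 :: 'a) then 0 else real q)"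
      by (intro sum_mono inner)
    moreover have "(\<Sum>b\<in>UNIV. if b = (0 :: 'a) then 0 else real q) > 0"
      by (rule sum_pos2[of _ 1]) (use q_gt_2 in auto)
    ultimately have A: "(\<Sum>b\<in>UNIV. \<Sum>c\<in>UNIV. ?w (b\<^sup>2 + c\<^sup>2)) > 0" by linarith
    have "(\<Sum>x\<in>deg_lt (degree (P * Q)). ?w (residue_coeff (P * Q) (x\<^sup>2))) = real q ^ (g + l + 1) * ?w 0"
      using deg l by (intro quadratic_sum_even[OF _ _ w]) auto
    moreover have "(\<Sum>x\<in>deg_lt (degree Q). \<Sum>c\<in>UNIV. ?w (residue_coeff Q (x\<^sup>2) + c\<^sup>2)) =
        real q ^ l * (\<Sum>b\<in>UNIV. \<Sum>c\<in>UNIV. ?w (b\<^sup>2 + c\<^sup>2))"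
      using QD l by (intro quadratic_sum_odd[OF _ w']) auto
    ultimately have "real q ^ (g + l + 1) * ?w 0 = ?e * (real q ^ g * (real q ^ l * (\<Sum>b\<in>UNIV. \<Sum>c\<in>UNIV. ?w (b\<^sup>2 + c\<^sup>2))))"
      using prod[OF _ w] QD by (simp only: mult.assoc of_int_mult)
    moreover have "real q ^ (g + l + 1) * ?w 0 > 0" using q_gt_2 by auto
    moreover have "real q ^ g * (real q ^ l * (\<Sum>b\<in>UNIV. \<Sum>c\<in>UNIV. ?w (b\<^sup>2 + c\<^sup>2))) > 0"
      using A q_gt_2 by (intro mult_pos_pos) auto
    ultimately show ?thesis by (metis zero_less_mult_pos2)
  qed
  have "qr_prime P Q \<in> {-1, 0, 1}" "qr_prime Q P \<in> {-1, 0, 1}" by (rule qr_prime_cases)+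
  then show ?thesis using pos by auto
qed simp

text \<open>Reciprocity is applied to each prime factor of f, and multiplicativity modulo P
  reassembles f. The sums over f thereby become sums of a character modulo the fixed prime
  P.\<close>

lemma chi_eq_qr_prime:
  fixes P f :: "'a poly"
  assumes q4: "q mod 4 = 1" and P: "P \<in> monic_irred_deg (2 * g + 1)" and f: "lead_coeff f = 1"
  shows "chi P f = qr_prime f P"
proof -
  have "(\<Prod>Q\<in>#A. qr_prime P Q) = qr_prime (prod_mset A) P" if "\<And>Q. Q \<in># A \<Longrightarrow> \<exists>n. Q \<in> monic_irred_deg n" for A
    using that
  proof (induction A)
    case empty
    then show ?case using monic_irred_degD(2)[OF P] by simp
  next
    case (add Q A)
    then obtain n where "Q \<in> monic_irred_deg n" by auto
    then show ?case using add quadratic_reciprocity[OF q4 P] monic_irred_degD(2)[OF P]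
      by (simp add: qr_prime_mult)
  qed
  moreover have "\<exists>n. Q \<in> monic_irred_deg n" if "Q \<in># prime_factorization f" for Q
  proof -
    have "prime Q" using that by auto
    then show ?thesis by (auto simp: prime_iff_monic_irred monic_irred_deg_def monic_def)
  qed
  moreover have "prod_mset (prime_factorization f) = f"
  proof -
    have "f \<noteq> 0" using f by auto
    then show ?thesis by (simp add: prod_mset_prime_factorization normalize_monic[OF f])
  qed
  ultimately show ?thesis by (simp add: chi_def qr_symbol_def)
qed

end

section \<open>The functional equation\<close>

context odd_field
begin

section \<open>Euler's criterion modulo primes of odd degree\<close>

lemma poly_const_cong_iff:
  fixes P :: "'a poly"
  assumes "degree P > 0"
  shows "[[:a:] = [:b:]] (mod P) \<longleftrightarrow> a = b"
  using assms by (auto simp: cong_iff_dvd_diff dest!: dvd_imp_degree_le split: if_splits)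

text \<open>The cofactor 1 + q + ... + q^(n-1) is a sum of n odd terms. Its parity decides whether a
  nonsquare constant stays a nonsquare modulo a prime of degree n.\<close>

lemma euler_exponent_odd:
  assumes "odd n"
  obtains k where "odd k" "(q ^ n - 1) div 2 = ((q - 1) div 2) * k"
proof
  let ?k = "\<Sum>i<n. q ^ i"
  have "q ^ n - 1 = (q - 1) * ?k"
  proof -
    have "int (q ^ n - 1) = int ((q - 1) * ?k)"
      using q_gt_2 power_diff_1_eq[of "int q" n] by (simp add: of_nat_diff)
    then show ?thesis by (simp only: of_nat_eq_iff)
  qed
  moreover have "q - 1 = 2 * ((q - 1) div 2)" using odd_q by simp
  ultimately show "(q ^ n - 1) div 2 = ((q - 1) div 2) * ?k"
    by (metis mult.assoc nonzero_mult_div_cancel_left zero_neq_numeral)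
  show "odd ?k" using assms odd_q by (simp add: even_sum_iff)
qed

lemma const_power_odd:
  assumes "c \<noteq> 0" "odd n"
  shows "c ^ ((q ^ n - 1) div 2) = of_int (quad_char c)"
proof -
  obtain k where k: "odd k" "(q ^ n - 1) div 2 = ((q - 1) div 2) * k" using euler_exponent_odd[OF assms(2)] .
  have "c ^ ((q ^ n - 1) div 2) = (of_int (quad_char c)) ^ k"
    by (simp only: k(2) power_mult euler_field[OF assms(1)])
  then show ?thesis using quad_char_cases[OF assms(1)] k(1) by auto
qed

lemma square_power:
  fixes P :: "'a poly"
  assumes P: "prime_elem P" and f: "qr_prime f P = 1"
  shows "[f ^ ((q ^ degree P - 1) div 2) = 1] (mod P)"
proof -
  obtain x where x: "P dvd x\<^sup>2 - f" and nf: "\<not> P dvd f" using f by (auto simp: qr_prime_def split: if_splits)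
  have xf: "[x\<^sup>2 = f] (mod P)" using x by (simp add: cong_iff_dvd_diff)
  have "\<not> P dvd x\<^sup>2" using cong_dvd_iff[OF xf] nf by simp
  then have nx: "\<not> P dvd x" using P by (simp add: prime_elem_dvd_power_iff)
  have e: "2 * ((q ^ degree P - 1) div 2) = q ^ degree P - 1" using odd_q by simp
  have "[f ^ ((q ^ degree P - 1) div 2) = (x\<^sup>2) ^ ((q ^ degree P - 1) div 2)] (mod P)"
    by (rule cong_pow[OF cong_sym[OF xf]])
  also have "(x\<^sup>2) ^ ((q ^ degree P - 1) div 2) = x ^ (q ^ degree P - 1)"
    by (simp only: power_mult[symmetric] e)
  also have "[x ^ (q ^ degree P - 1) = 1] (mod P)" using fermat_poly[OF P nx] by (simp add: q_def)
  finally show ?thesis .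
qed

text \<open>A residue has (q^n - 1)/2-th power 1 modulo P; for a nonzero constant c that power is
  \<open>quad_char c\<close>, and constants congruent modulo P are equal.\<close>

lemma qr_prime_const:
  fixes P :: "'a poly"
  assumes P: "P \<in> monic_irred_deg n" and n: "odd n"
  shows "qr_prime [:c:] P = quad_char c"
proof (cases "c = 0")
  case False
  note PD = monic_irred_degD[OF P]
  have nd: "\<not> P dvd [:c:]" using False PD by (auto dest!: dvd_imp_degree_le)
  have iff: "qr_prime [:c:] P = 1 \<longleftrightarrow> quad_char c = 1"
  proof
    assume "qr_prime [:c:] P = 1"
    then have "[[:c:] ^ ((q ^ n - 1) div 2) = 1] (mod P)" using square_power[OF PD(2)] PD(3) by blast
    then have "[[:of_int (quad_char c):] = [:1:]] (mod P)"
      by (simp only: poly_const_pow const_power_odd[OF False n] one_pCons)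
    then have "of_int (quad_char c) = (1 :: 'a)" using PD by (simp add: poly_const_cong_iff)
    then show "quad_char c = 1" using quad_char_cases[OF False] eq_uminus_iff[of 1] by auto
  next
    assume "quad_char c = 1"
    then obtain x where "x\<^sup>2 = c" by (auto simp: quad_char_eq_1_iff)
    then have "[:c:] = [:x:]\<^sup>2" by (simp add: poly_const_pow)
    then show "qr_prime [:c:] P = 1" using nd by (metis qr_prime_square)
  qed
  have "qr_prime [:c:] P = 1 \<or> qr_prime [:c:] P = -1" using nd by (simp add: qr_prime_def)
  then show ?thesis using iff quad_char_cases[OF False] by auto
qed (simp add: qr_prime_def)

text \<open>Nonresidues are reduced to residues by twisting with a nonsquare constant, which stays a nonresidue
  modulo a prime of odd degree.\<close>
lemma euler_criterion_odd_degree: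
  fixes P :: "'a poly"
  assumes P: "P \<in> monic_irred_deg n" and n: "odd n" and f: "qr_prime f P = s" "s = 1 \<or> s = -1"
  shows "[f ^ ((q ^ n - 1) div 2) = of_int s] (mod P)"
proof -
  note PD = monic_irred_degD[OF P]
  show ?thesis
  proof (cases "s = 1")
    case True
    then show ?thesis using square_power[OF PD(2)] f PD by auto
  next
    case False
    then have s: "s = -1" using f by simp
    obtain c where c: "quad_char c = -1" using ex_nonsquare by blast
    then have c0: "c \<noteq> 0" by auto
    let ?e = "(q ^ n - 1) div 2"
    have "qr_prime ([:c:] * f) P = 1"
      unfolding qr_prime_mult[OF PD(2)] qr_prime_const[OF P n] using c f s by simp
    then have "[([:c:] * f) ^ ?e = 1] (mod P)" using square_power[OF PD(2)] PD by blast
    moreover have "([:c:] * f) ^ ?e = - (f ^ ?e)"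
      by (simp only: power_mult_distrib poly_const_pow const_power_odd[OF c0 n] c) (simp add: one_pCons)
    ultimately have "[- (f ^ ?e) = 1] (mod P)" by simp
    then have "P dvd - (f ^ ?e + 1)" by (simp add: cong_iff_dvd_diff)
    then have "P dvd f ^ ?e + 1" by (simp only: dvd_minus_iff)
    then show ?thesis by (simp add: s cong_iff_dvd_diff)
  qed
qed

text \<open>Evaluates the double sum of the quadratic character of the residue coefficient of f h, over f monic
  of degree n and residues h, once by summing over h first and once by summing over f first.\<close>
lemma functional_equation:
  fixes P :: "'a poly"
  assumes P: "P \<in> monic_irred_deg (2 * g + 1)" and n: "n \<le> 2 * g"
  shows "real q ^ g * real_of_int (\<Sum>f\<in>monic_deg n. qr_prime f P) =
    real q ^ n * real_of_int (\<Sum>f\<in>monic_deg (2 * g - n). qr_prime f P)"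
proof -
  note PD = monic_irred_degD[OF P]
  have odd: "odd (2 * g + 1)" by simp
  let ?N = "2 * g + 1" and ?m = "2 * g - n"
  let ?r = "residue_coeff P"
  let ?w = "\<lambda>t. real_of_int (quad_char t)"
  let ?\<chi> = "\<lambda>h. real_of_int (qr_prime h P)"
  have w: "(\<Sum>t\<in>UNIV. ?w t) = 0" using sum_quad_char by (metis of_int_0 of_int_sum)
  have nd1: "\<not> P dvd 1" using PD prime_elem_not_unit by blast
  \<comment> \<open>Summing over h first gives a Gauss sum, which is (f/P) times a constant
    independent of f.\<close>
  have gauss: "(\<Sum>h\<in>deg_lt ?N. ?\<chi> h * ?w (?r (f * h))) = ?\<chi> f * real q ^ g * (real q - 1)" if "\<not> P dvd f" for f
  proof -
    have "(\<Sum>h\<in>deg_lt ?N. ?\<chi> h * ?w (?r h)) = real q ^ g * (real q - 1)"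
      using twisted_sum[OF PD(2) _ nd1 w] quadratic_sum_odd[OF PD(3) w] PD(3)
      by (simp add: sum_quad_char_square)
    then show ?thesis using character_sum_twist[OF PD(2) that, of ?w] PD(3) by simp
  qed
  have nd: "\<not> P dvd f" if "f \<in> monic_deg n" for f
    using that n PD by (auto simp: monic_deg_def monic_def dest!: dvd_imp_degree_le)
  \<comment> \<open>The monic f form the translate T^n + \<open>deg_lt n\<close>. The sum over it
    vanishes unless h is orthogonal to \<open>deg_lt n\<close>, that is of degree at most 2g - n,
    and then the pairing reads the coefficient of T^(2g-n).\<close>
  have inner: "(\<Sum>f\<in>monic_deg n. ?w (?r (f * h))) = (if h \<in> deg_lt (?N - n) then real q ^ n * ?w (coeff h ?m) else 0)"
    if h: "h \<in> deg_lt ?N" for h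
  proof -
    have "(\<Sum>f\<in>monic_deg n. ?w (?r (f * h))) = (\<Sum>y\<in>deg_lt n. ?w (?r (monom 1 n * h) + ?r (y * h)))"
      by (simp add: sum_monic_deg distrib_right residue_coeff_add)
    also have "\<dots> = (if h \<in> deg_lt (?N - n) then real q ^ n * ?w (coeff h ?m) else 0)"
    proof (cases "h \<in> deg_lt (?N - n)")
      case True
      then have "?r (y * h) = 0" if "y \<in> deg_lt n" for y
        using n PD that by (intro residue_coeff_orthogonal[of n]) auto
      moreover have "?r (monom 1 n * h) = coeff h ?m"
      proof -
        have "monom 1 n * h \<in> deg_lt (degree P)"
          using True n PD deg_lt_monom[of n "Suc n" 1] by (intro deg_lt_mult[of _ "Suc n" _ "?N - n"]) auto
        then show ?thesis using n PD by (simp add: residue_coeff_low coeff_monom_mult)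
      qed
      ultimately show ?thesis using True by (simp add: card_deg_lt_q)
    next
      case False
      then obtain y0 where "y0 \<in> deg_lt n" "?r (y0 * h) \<noteq> 0"
        using residue_coeff_nondegenerate[of n P h] n h PD by auto
      then have "(\<Sum>y\<in>deg_lt n. ?w (?r (monom 1 n * h) + ?r (y * h))) = 0"
        by (intro sum_over_linear_form[OF _ _ _ _ w]) (auto simp: distrib_right residue_coeff_add residue_coeff_smult)
      then show ?thesis using False by simp
    qed
    finally show ?thesis .
  qed
  \<comment> \<open>For h equal to c times a monic polynomial, (c/P) = \<open>quad_char c\<close>
    cancels the weight at c, so all nonzero c contribute equally. These q - 1 copies match the
    factor q - 1 of the Gauss sum.\<close>
  have top: "(\<Sum>y\<in>deg_lt ?m. ?\<chi> (monom c ?m + y)) * ?w c = (if c = 0 then 0 else real_of_int (\<Sum>f\<in>monic_deg ?m. qr_prime f P))" for c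
  proof (cases "c = 0")
    case False
    have "bij_betw (smult c) (deg_lt ?m) (deg_lt ?m)"
      by (rule bij_betwI[of _ _ _ "smult (1 / c)"]) (use False in \<open>auto simp: deg_lt_smult\<close>)
    then have "(\<Sum>y\<in>deg_lt ?m. ?\<chi> (monom c ?m + y)) = (\<Sum>y\<in>deg_lt ?m. ?\<chi> (monom c ?m + smult c y))"
      by (rule sum.reindex_bij_betw[symmetric])
    also have "\<dots> = (\<Sum>y\<in>deg_lt ?m. ?\<chi> ([:c:] * (monom 1 ?m + y)))" by (simp add: smult_add_right smult_monom)
    also have "\<dots> = ?w c * real_of_int (\<Sum>f\<in>monic_deg ?m. qr_prime f P)"
      by (simp only: qr_prime_mult[OF PD(2)] qr_prime_const[OF P odd] sum_monic_deg) (simp add: sum_distrib_left)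
    finally show ?thesis using quad_char_cases[OF False] False by auto
  qed simp
  have "real q ^ g * (real q - 1) * real_of_int (\<Sum>f\<in>monic_deg n. qr_prime f P) =
      (\<Sum>f\<in>monic_deg n. ?\<chi> f * real q ^ g * (real q - 1))"
    by (simp add: sum_distrib_left mult_ac)
  also have "\<dots> = (\<Sum>f\<in>monic_deg n. \<Sum>h\<in>deg_lt ?N. ?\<chi> h * ?w (?r (f * h)))"
    by (intro sum.cong refl gauss[symmetric] nd)
  also have "\<dots> = (\<Sum>h\<in>deg_lt ?N. ?\<chi> h * (\<Sum>f\<in>monic_deg n. ?w (?r (f * h))))"
    by (subst sum.swap) (simp add: sum_distrib_left)
  also have "\<dots> = (\<Sum>h\<in>deg_lt ?N. if h \<in> deg_lt (?N - n) then real q ^ n * (?\<chi> h * ?w (coeff h ?m)) else 0)"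
    by (intro sum.cong refl) (simp add: inner)
  also have "\<dots> = (\<Sum>h\<in>deg_lt ?N \<inter> deg_lt (?N - n). real q ^ n * (?\<chi> h * ?w (coeff h ?m)))"
    by (simp add: sum.inter_restrict)
  also have "deg_lt ?N \<inter> deg_lt (?N - n) = (deg_lt (Suc ?m) :: 'a poly set)" using deg_lt_mono[of "?N - n" ?N] n
    by (auto simp: Suc_diff_le)
  also have "(\<Sum>h\<in>deg_lt (Suc ?m). real q ^ n * (?\<chi> h * ?w (coeff h ?m))) =
      (\<Sum>c\<in>UNIV. \<Sum>y\<in>deg_lt ?m. real q ^ n * (?\<chi> (monom c ?m + y) * ?w (coeff (monom c ?m + y) ?m)))"
    by (rule sum_deg_lt_Suc)
  also have "\<dots> = (\<Sum>c\<in>UNIV. \<Sum>y\<in>deg_lt ?m. real q ^ n * (?\<chi> (monom c ?m + y) * ?w c))"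
    by (intro sum.cong refl) (simp add: deg_lt_def)
  also have "\<dots> = real q ^ n * (\<Sum>c\<in>UNIV. (\<Sum>y\<in>deg_lt ?m. ?\<chi> (monom c ?m + y)) * ?w c)"
    by (simp add: sum_distrib_left sum_distrib_right mult.assoc)
  also have "\<dots> = real q ^ n * (\<Sum>c\<in>UNIV - {0 :: 'a}. real_of_int (\<Sum>f\<in>monic_deg ?m. qr_prime f P))"
    unfolding top by (subst sum.remove[of _ 0]) auto
  also have "\<dots> = (real q - 1) * (real q ^ n * real_of_int (\<Sum>f\<in>monic_deg ?m. qr_prime f P))"
    using q_gt_2 by (simp add: q_def of_nat_diff del: of_int_sum)
  finally have "(real q - 1) * (real q ^ g * real_of_int (\<Sum>f\<in>monic_deg n. qr_prime f P)) =
    (real q - 1) * (real q ^ n * real_of_int (\<Sum>f\<in>monic_deg ?m. qr_prime f P))" by (simp only: mult_ac)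
  then show ?thesis using q_gt_2 by (simp del: of_int_sum)
qed

end

section \<open>Counting irreducible polynomials\<close>

context odd_field
begin

definition prime_count :: "nat \<Rightarrow> nat" where
  "prime_count n = card (monic_irred_deg n :: 'a poly set)"

lemma card_monic_multiples:
  fixes h :: "'a poly"
  assumes h: "h \<in> monic_deg d" and d: "d \<le> n"
  shows "card {f \<in> monic_deg n. h dvd f} = q ^ (n - d)"
proof -
  have lh: "lead_coeff h = 1" "degree h = d" "h \<noteq> 0" using h by (auto simp: monic_deg_def monic_def)
  have "{f \<in> monic_deg n. h dvd f} = (\<lambda>c. h * c) ` monic_deg (n - d)"
  proof (intro set_eqI iffI)
    fix f assume "f \<in> {f \<in> monic_deg n. h dvd f}"
    then obtain c where c: "f = h * c" and f: "lead_coeff f = 1" "degree f = n"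
      by (auto simp: monic_deg_def monic_def)
    have "c \<noteq> 0" using c f by auto
    then have "degree c = n - d" using c f lh by (simp add: degree_mult_eq)
    moreover have "lead_coeff c = 1" using c f lh by (metis lead_coeff_mult mult_1)
    ultimately show "f \<in> (\<lambda>c. h * c) ` monic_deg (n - d)" using c by (auto simp: monic_deg_def monic_def)
  next
    fix f assume "f \<in> (\<lambda>c. h * c) ` monic_deg (n - d)"
    then obtain c where "f = h * c" "c \<in> monic_deg (n - d)" by blast
    then have c: "f = h * c" "lead_coeff c = 1" "degree c = n - d"
      by (auto simp: monic_deg_def monic_def)
    then have "c \<noteq> 0" by auto
    then have "degree f = n" using c lh d by (simp add: degree_mult_eq)
    moreover have "lead_coeff f = 1" using c lh by (metis lead_coeff_mult mult_1)
    ultimately show "f \<in> {f \<in> monic_deg n. h dvd f}" using c by (auto simp: monic_deg_def monic_def)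
  qed
  then show ?thesis using lh by (simp add: card_image inj_on_def card_monic_deg q_def)
qed

text \<open>The degree is the sum of multiplicity times degree over the prime factors, and a
  multiplicity counts the j with P^j dividing f. The ranges do not depend on f, so the sums can be
  exchanged with a sum over f.\<close>

lemma degree_eq_sum_multiplicity:
  fixes f :: "'a poly"
  assumes f: "f \<in> monic_deg n"
  shows "n = (\<Sum>d\<in>{1..n}. \<Sum>P\<in>monic_irred_deg d. \<Sum>j\<in>{1..n}. d * of_bool (P ^ j dvd f))"
proof -
  have lf: "lead_coeff f = 1" "degree f = n" "f \<noteq> 0" using f by (auto simp: monic_deg_def monic_def)
  let ?A = "prime_factorization f"
  have dvd_bound: "j * degree P \<le> n" if "P ^ j dvd f" "P \<noteq> 0" for P j
    using dvd_imp_degree_le[OF that(1)] lf that(2) by (simp add: degree_power_eq)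
  have "n = degree (\<Prod>P\<in>prime_factors f. P ^ multiplicity P f)"
    using lf by (simp add: prod_prime_factors normalize_monic)
  also have "\<dots> = (\<Sum>P\<in>prime_factors f. degree (P ^ multiplicity P f))"
    by (rule degree_prod_sum_eq) auto
  also have "\<dots> = (\<Sum>P\<in>prime_factors f. count ?A P * degree P)"
  proof (rule sum.cong[OF refl])
    fix P assume "P \<in># ?A"
    then have P: "prime P" by blast
    then have "P \<noteq> 0" by auto
    then show "degree (P ^ multiplicity P f) = count ?A P * degree P"
      using P by (simp add: degree_power_eq count_prime_factorization_prime)
  qed
  also have "\<dots> = (\<Sum>P\<in>(\<Union>d\<in>{1..n}. monic_irred_deg d). count ?A P * degree P)"
  proof (rule sum.mono_neutral_left)
    show "prime_factors f \<subseteq> (\<Union>d\<in>{1..n}. monic_irred_deg d)"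
    proof
      fix P assume P: "P \<in># ?A"
      then have irr: "irreducible P" "lead_coeff P = 1" and d: "P dvd f"
        using prime_iff_monic_irred by auto
      then have "degree P > 0" using monic_irred_degD(6)[of P "degree P"] by (simp add: monic_irred_deg_def monic_def)
      moreover have "degree P \<le> n" using dvd_imp_degree_le[OF d] lf by auto
      ultimately show "P \<in> (\<Union>d\<in>{1..n}. monic_irred_deg d)" using irr by (auto simp: monic_irred_deg_def monic_def)
    qed
    show "\<forall>P\<in>(\<Union>d\<in>{1..n}. monic_irred_deg d) - prime_factors f. count ?A P * degree P = 0"
      by (auto simp: not_in_iff)
  qed auto
  also have "\<dots> = (\<Sum>d\<in>{1..n}. \<Sum>P\<in>monic_irred_deg d. count ?A P * degree P)"
    by (rule sum.UNION_disjoint) (auto dest: monic_irred_degD(3))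
  also have "\<dots> = (\<Sum>d\<in>{1..n}. \<Sum>P\<in>monic_irred_deg d. \<Sum>j\<in>{1..n}. d * of_bool (P ^ j dvd f))"
  proof (intro sum.cong refl)
    fix d and P :: "'a poly" assume P: "P \<in> monic_irred_deg d"
    note PD = monic_irred_degD[OF P]
    have pr: "prime P" using PD by (simp add: prime_iff_monic_irred)
    have "P ^ j dvd f \<longleftrightarrow> j \<le> multiplicity P f" for j
      using PD lf prime_elem_not_unit[OF PD(2)] by (intro power_dvd_iff_le_multiplicity) auto
    moreover have "j \<le> n" if "P ^ j dvd f" for j
    proof -
      have "j * 1 \<le> j * d" using PD by (intro mult_left_mono) auto
      also have "j * d \<le> n" using dvd_bound[OF that PD(5)] PD(3) by simp
      finally show ?thesis by simp
    qed
    ultimately have "{1..n} \<inter> {j. P ^ j dvd f} = {1..multiplicity P f}" by auto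
    then have "(\<Sum>j\<in>{1..n}. d * of_bool (P ^ j dvd f)) = d * multiplicity P f"
      by (simp flip: sum_distrib_left)
    then show "count ?A P * degree P = (\<Sum>j\<in>{1..n}. d * of_bool (P ^ j dvd f))"
      using pr PD by (simp add: count_prime_factorization_prime)
  qed
  finally show ?thesis .
qed

text \<open>Sum the previous identity over all monic f of degree n; P^j divides q^(n - d j) of them.
  This plays the role of the logarithmic derivative of the zeta function.\<close>

lemma degree_count_identity:
  "real n * real q ^ n = (\<Sum>d\<in>{1..n}. \<Sum>j\<in>{1..n}. real (d * prime_count d) * (if d * j \<le> n then real q ^ (n - d * j) else 0))"
proof -
  have count: "(\<Sum>f\<in>monic_deg n. real (of_bool (P ^ j dvd f))) = (if d * j \<le> n then real q ^ (n - d * j) else 0)"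
    if P: "P \<in> monic_irred_deg d" for P :: "'a poly" and d j
  proof -
    note PD = monic_irred_degD[OF P]
    have Pj: "P ^ j \<in> monic_deg (d * j)"
      using PD lead_coeff_power[of P j] by (auto simp: monic_deg_def monic_def degree_power_eq mult.commute)
    have "(\<Sum>f\<in>monic_deg n. real (of_bool (P ^ j dvd f))) = real (card {f \<in> monic_deg n. P ^ j dvd f})"
    proof -
      have "{f \<in> monic_deg n. P ^ j dvd f} = monic_deg n \<inter> {f. P ^ j dvd f}" by auto
      then show ?thesis by simp
    qed
    also have "\<dots> = (if d * j \<le> n then real q ^ (n - d * j) else 0)"
    proof (cases "d * j \<le> n")
      case True
      then show ?thesis using card_monic_multiples[OF Pj True] by simp
    next
      case False
      have "{f \<in> monic_deg n. P ^ j dvd f} = {}"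
        using Pj False by (auto simp: monic_deg_def monic_def dest!: dvd_imp_degree_le)
      then show ?thesis using False by simp
    qed
    finally show ?thesis .
  qed
  have "real n * real q ^ n = (\<Sum>f\<in>(monic_deg n :: 'a poly set). real n)" by (simp add: card_monic_deg q_def)
  also have "\<dots> = (\<Sum>f\<in>(monic_deg n :: 'a poly set). \<Sum>d\<in>{1..n}. \<Sum>P\<in>monic_irred_deg d. \<Sum>j\<in>{1..n}. real d * real (of_bool (P ^ j dvd f)))"
  proof (rule sum.cong[OF refl])
    fix f :: "'a poly" assume f: "f \<in> monic_deg n"
    show "real n = (\<Sum>d\<in>{1..n}. \<Sum>P\<in>monic_irred_deg d. \<Sum>j\<in>{1..n}. real d * real (of_bool (P ^ j dvd f)))"
      using arg_cong[OF degree_eq_sum_multiplicity[OF f], of real] by (simp only: of_nat_sum of_nat_mult)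
  qed
  also have "\<dots> = (\<Sum>d\<in>{1..n}. \<Sum>P\<in>monic_irred_deg d. \<Sum>j\<in>{1..n}. \<Sum>f\<in>(monic_deg n :: 'a poly set). real d * real (of_bool (P ^ j dvd f)))"
    by (subst sum.swap, rule sum.cong[OF refl], subst sum.swap, rule sum.cong[OF refl], rule sum.swap)
  also have "\<dots> = (\<Sum>d\<in>{1..n}. \<Sum>P\<in>(monic_irred_deg d :: 'a poly set). \<Sum>j\<in>{1..n}. real d * (if d * j \<le> n then real q ^ (n - d * j) else 0))"
    by (intro sum.cong refl) (simp only: count flip: sum_distrib_left)
  also have "\<dots> = (\<Sum>d\<in>{1..n}. \<Sum>j\<in>{1..n}. \<Sum>P\<in>(monic_irred_deg d :: 'a poly set). real d * (if d * j \<le> n then real q ^ (n - d * j) else 0))"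
    by (intro sum.cong refl sum.swap)
  also have "\<dots> = (\<Sum>d\<in>{1..n}. \<Sum>j\<in>{1..n}. real (d * prime_count d) * (if d * j \<le> n then real q ^ (n - d * j) else 0))"
    by (intro sum.cong refl) (simp add: prime_count_def)
  finally show ?thesis .
qed

text \<open>Dividing the degree count by q^n makes its summands independent of n; subtracting the counts for
  n and n - 1 isolates the divisors of n.\<close>
lemma sum_divisors_prime_count:
  assumes n: "n > 0"
  shows "(\<Sum>d | d dvd n. d * prime_count d) = q ^ n"
proof -
  let ?S = "\<lambda>n. {(d, j). d \<in> {1..n} \<and> j \<in> {1..n} \<and> d * j \<le> n}"
  let ?t = "\<lambda>(d, j). real (d * prime_count d) / real q ^ (d * j)"
  have fin: "finite (?S m)" for m :: nat by (rule finite_subset[of _ "{1..m} \<times> {1..m}"]) auto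
  have id: "real m = sum ?t (?S m)" for m
  proof -
    have qp: "real q ^ m > 0" using q_gt_2 by simp
    have "real m = (real m * real q ^ m) / real q ^ m" using qp by simp
    also have "\<dots> = (\<Sum>d\<in>{1..m}. \<Sum>j\<in>{1..m}. real (d * prime_count d) * (if d * j \<le> m then real q ^ (m - d * j) else 0) / real q ^ m)"
      by (simp only: degree_count_identity sum_divide_distrib)
    also have "\<dots> = (\<Sum>d\<in>{1..m}. \<Sum>j\<in>{1..m}. if d * j \<le> m then ?t (d, j) else 0)"
      using q_gt_2 by (intro sum.cong refl) (auto simp: power_diff)
    also have "\<dots> = (\<Sum>z\<in>{1..m} \<times> {1..m}. if fst z * snd z \<le> m then ?t z else 0)"
      by (simp only: sum.cartesian_product) (auto intro!: sum.cong)
    also have "\<dots> = sum ?t ({z \<in> {1..m} \<times> {1..m}. fst z * snd z \<le> m})"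
      by (rule sum.inter_filter[symmetric]) simp
    also have "{z \<in> {1..m} \<times> {1..m}. fst z * snd z \<le> m} = ?S m" by auto
    finally show ?thesis .
  qed
  let ?D = "{(d, j). d \<in> {1..n} \<and> j \<in> {1..n} \<and> d * j = n}"
  \<comment> \<open>A pair counted for n but not for n - 1 has d j = n, because d and j are both at
    most d j.\<close>
  have split: "?S n = ?S (n - 1) \<union> ?D"
  proof (intro set_eqI iffI)
    fix z assume z: "z \<in> ?S n"
    obtain d j where dj: "z = (d, j)" by (cases z)
    show "z \<in> ?S (n - 1) \<union> ?D"
    proof (cases "d * j = n")
      case False
      then have "d * j \<le> n - 1" "d \<ge> 1" "j \<ge> 1" using z dj by auto
      moreover from this have "d * 1 \<le> d * j" "1 * j \<le> d * j" by (intro mult_le_mono; simp)+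
      ultimately have "d \<le> n - 1" "j \<le> n - 1" by linarith+
      then show ?thesis using dj \<open>d * j \<le> n - 1\<close> \<open>d \<ge> 1\<close> \<open>j \<ge> 1\<close> by auto
    qed (use z dj in auto)
  qed (use n in auto)
  have disj: "?S (n - 1) \<inter> ?D = {}" using n by auto
  have "real n = sum ?t (?S (n - 1)) + sum ?t ?D"
    unfolding id[of n] split
    by (rule sum.union_disjoint[OF fin _ disj]) (rule finite_subset[OF _ fin[of n]], auto)
  then have "real n = real (n - 1) + sum ?t ?D" using id[of "n - 1"] by simp
  then have one: "sum ?t ?D = 1" using n by (simp add: of_nat_diff)
  have bij: "sum ?t ?D = (\<Sum>d | d dvd n. real (d * prime_count d) / real q ^ n)"
  proof (rule sum.reindex_bij_witness[where i = "\<lambda>d. (d, n div d)" and j = fst])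
    fix d assume "d \<in> {d. d dvd n}"
    then obtain k where "n = d * k" by auto
    then show "(d, n div d) \<in> ?D" using n by (auto simp: Suc_le_eq)
  qed auto
  have "real (\<Sum>d | d dvd n. d * prime_count d) = real q ^ n"
    using one q_gt_2 unfolding bij by (simp add: field_simps flip: sum_divide_distrib)
  then show ?thesis by (metis of_nat_eq_iff of_nat_power)
qed

lemma prime_count_le: 
  assumes "n > 0"
  shows "n * prime_count n \<le> q ^ n"
proof -
  have "n * prime_count n \<le> (\<Sum>d | d dvd n. d * prime_count d)"
    by (rule member_le_sum) (use assms in auto)
  then show ?thesis using sum_divisors_prime_count[OF assms] by simp
qed

text \<open>A proper divisor of 2g + 1 is at most g, and each contributes at most q^g by
  \<open>prime_count_le\<close>.\<close>

lemma prime_count_ge: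
  "q ^ (2 * g + 1) \<le> (2 * g + 1) * prime_count (2 * g + 1) + g * q ^ g"
proof -
  let ?N = "2 * g + 1"
  have "q ^ ?N = (\<Sum>d | d dvd ?N. d * prime_count d)" using sum_divisors_prime_count[of ?N] by simp
  also have "\<dots> \<le> (\<Sum>d\<in>insert ?N {1..g}. d * prime_count d)"
  proof (rule sum_mono2)
    show "{d. d dvd ?N} \<subseteq> insert ?N {1..g}"
    proof
      fix d assume "d \<in> {d. d dvd ?N}"
      then obtain k where k: "?N = d * k" by auto
      then have "d > 0" by (metis add_is_0 mult_0 neq0_conv one_neq_zero)
      moreover have "k = 1 \<or> k \<ge> 2" using k by (cases k) auto
      moreover have "d \<le> g" if "k \<ge> 2"
      proof -
        have "d * 2 \<le> d * k" using that by simp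
        then show ?thesis using k by linarith
      qed
      ultimately show "d \<in> insert ?N {1..g}" using k by auto
    qed
  qed auto
  also have "\<dots> = ?N * prime_count ?N + (\<Sum>d\<in>{1..g}. d * prime_count d)" by (subst sum.insert) auto
  also have "(\<Sum>d\<in>{1..g}. d * prime_count d) \<le> (\<Sum>d\<in>{1..g}. q ^ g)"
  proof (rule sum_mono)
    fix d assume d: "d \<in> {1..g}"
    then have "d * prime_count d \<le> q ^ d" by (intro prime_count_le) auto
    also have "\<dots> \<le> q ^ g" using d q_gt_2 by (intro power_increasing) auto
    finally show "d * prime_count d \<le> q ^ g" .
  qed
  also have "(\<Sum>d\<in>{1..g}. q ^ g) = g * q ^ g" by simp
  finally show ?thesis by simp
qed

end

section \<open>Character sums over primes\<close>

lemma deg_lt_power: "u \<in> deg_lt (Suc a) \<Longrightarrow> u ^ n \<in> deg_lt (Suc (a * n))"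
  unfolding deg_lt_degree_le by (rule order_trans[OF degree_power_le]) (simp add: mult_right_mono)

text \<open>The position of the leading digit is the quotient of the degree by M. Distinct digits at
  the same position would differ, after multiplication by T^(M i), by something of degree below M
  i.\<close>

lemma leading_digit_unique:
  fixes a a' b b' :: "'a::field_gcd poly"
  assumes a: "a \<in> deg_lt M" "a \<noteq> 0" "b \<in> deg_lt (M * i)" and a': "a' \<in> deg_lt M" "a' \<noteq> 0" "b' \<in> deg_lt (M * i')"
    and eq: "a * monom 1 (M * i) + b = a' * monom 1 (M * i') + b'"
  shows "i = i'" "a = a'"
proof -
  have idx: "degree (x * monom 1 (M * j) + y) div M = j" if "x \<in> deg_lt M" "x \<noteq> 0" "y \<in> deg_lt (M * j)" for x y :: "'a poly" and j
  proof -
    have d: "degree (x * monom 1 (M * j)) = degree x + M * j"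
      using that by (simp add: degree_mult_eq degree_monom_eq monom_eq_0_iff)
    have "degree (x * monom 1 (M * j) + y) = degree x + M * j"
    proof (cases "y = 0")
      case False
      then have "degree y < degree (x * monom 1 (M * j))" using that d by (auto simp: mem_deg_lt_iff)
      then show ?thesis using d degree_add_eq_left by metis
    qed (simp add: d)
    moreover have "degree x < M" using that by (auto simp: mem_deg_lt_iff)
    ultimately show ?thesis by simp
  qed
  show i: "i = i'" using idx[OF a] idx[OF a'] eq by simp
  show "a = a'"
  proof (rule ccontr)
    assume ne: "a \<noteq> a'"
    have "(a - a') * monom 1 (M * i) = b' - b" using eq i by (simp add: algebra_simps)
    moreover have "b' - b \<in> deg_lt (M * i)" using a a' i by (intro deg_lt_diff) auto
    ultimately have "(a - a') * monom 1 (M * i) \<in> deg_lt (M * i)" by simp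
    then show False using ne by (auto simp: mem_deg_lt_iff degree_mult_eq degree_monom_eq monom_eq_0_iff)
  qed
qed

text \<open>The bound on b records that the digits have degree below m, which may be much smaller
  than M; the gap left below T^(M i) is the room needed for squaring.\<close>

lemma leading_digit:
  fixes u :: "nat \<Rightarrow> 'a::field_gcd poly"
  assumes u: "\<And>j. j < J \<Longrightarrow> u j \<in> deg_lt m" and nz: "\<exists>j<J. u j \<noteq> 0"
  obtains i b where "i < J" "u i \<noteq> 0" "(\<Sum>j<J. u j * monom 1 (M * j)) = u i * monom 1 (M * i) + b"
    "b = 0 \<or> i > 0 \<and> b \<in> deg_lt (M * (i - 1) + m)"
proof -
  define i where "i = Max {j. j < J \<and> u j \<noteq> 0}"
  have fin: "finite {j. j < J \<and> u j \<noteq> 0}" and ne: "{j. j < J \<and> u j \<noteq> 0} \<noteq> {}" using nz by auto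
  have i: "i < J" "u i \<noteq> 0" using Max_in[OF fin ne] by (auto simp: i_def)
  have max: "u j = 0" if "j < J" "j > i" for j
  proof (rule ccontr)
    assume "u j \<noteq> 0"
    then have "j \<le> i" unfolding i_def using that fin by (intro Max_ge) auto
    with that show False by simp
  qed
  let ?b = "\<Sum>j<i. u j * monom 1 (M * j)"
  have "(\<Sum>j<J. u j * monom 1 (M * j)) = (\<Sum>j<Suc i. u j * monom 1 (M * j))"
    by (rule sum.mono_neutral_right) (use i max in auto)
  then have eq: "(\<Sum>j<J. u j * monom 1 (M * j)) = u i * monom 1 (M * i) + ?b" by (simp add: add.commute)
  have "?b = 0 \<or> i > 0 \<and> ?b \<in> deg_lt (M * (i - 1) + m)"
  proof (cases "i = 0")
    case False
    have "?b \<in> deg_lt (M * (i - 1) + m)"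
    proof (rule deg_lt_sum)
      fix j assume "j \<in> {..<i}"
      then have j: "j < J" "j \<le> i - 1" using i by auto
      have "M * j \<le> M * (i - 1)" using j by simp
      moreover have "(monom 1 (M * j) :: 'a poly) \<in> deg_lt (Suc (M * j))" by (rule deg_lt_monom) simp
      ultimately show "u j * monom 1 (M * j) \<in> deg_lt (M * (i - 1) + m)"
        by (intro deg_lt_mult[OF u[OF j(1)]]) auto
    qed
    then show ?thesis using False by simp
  qed simp
  then show ?thesis using that[OF i eq] by blast
qed

text \<open>The cross term has degree below M (i - 1) + M i + 2m + d, so 2m + d <= M keeps it below
  T^(2 M i).\<close>

lemma leading_digit_square:
  fixes u b F :: "'a::field_gcd poly"
  assumes u: "u \<in> deg_lt m" and b: "b = 0 \<or> i > 0 \<and> b \<in> deg_lt (M * (i - 1) + m)"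
    and F: "F \<in> deg_lt (Suc d)" and M: "2 * m + d \<le> M"
  obtains \<beta> where "\<beta> \<in> deg_lt (M * (2 * i))"
    "(u * monom 1 (M * i) + b)\<^sup>2 * F = (u\<^sup>2 * F) * monom 1 (M * (2 * i)) + \<beta>"
proof -
  let ?T = "monom 1 (M * i) :: 'a poly"
  let ?\<beta> = "smult 2 (u * b * ?T * F) + b * b * F"
  have TT: "?T * ?T = monom 1 (M * (2 * i))" by (simp add: mult_monom mult_2 distrib_left)
  have "(u * ?T + b)\<^sup>2 * F = (u\<^sup>2 * F) * (?T * ?T) + (2 * (u * b * ?T * F) + b * b * F)"
    by (simp add: power2_eq_square algebra_simps)
  moreover have "2 * x = smult 2 x" for x :: "'a poly" by (simp add: numeral_poly)
  ultimately have eq: "(u * ?T + b)\<^sup>2 * F = (u\<^sup>2 * F) * monom 1 (M * (2 * i)) + ?\<beta>" by (simp only: TT)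
  have "?\<beta> \<in> deg_lt (M * (2 * i))"
  proof (cases "b = 0")
    case False
    then have b: "i > 0" "b \<in> deg_lt (M * (i - 1) + m)" using b by auto
    have Mi: "M * i = M * (i - 1) + M" using b by (cases i) auto
    have T: "?T \<in> deg_lt (Suc (M * i))" by (rule deg_lt_monom) simp
    have "u * b \<in> deg_lt (M * (i - 1) + 2 * m)" by (rule deg_lt_mult[OF u b(2)]) simp
    then have "u * b * ?T \<in> deg_lt (M * (i - 1) + 2 * m + M * i)" by (rule deg_lt_mult[OF _ T]) simp
    then have "u * b * ?T * F \<in> deg_lt (M * (2 * i))" by (rule deg_lt_mult[OF _ F]) (use M Mi in simp)
    moreover have "b * b \<in> deg_lt (2 * (M * (i - 1) + m))" by (rule deg_lt_mult[OF b(2) b(2)]) simp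
    then have "b * b * F \<in> deg_lt (M * (2 * i))" by (rule deg_lt_mult[OF _ F]) (use M Mi in simp)
    ultimately show ?thesis by (intro deg_lt_add deg_lt_smult)
  qed simp
  then show ?thesis using eq that by blast
qed

context odd_field
begin

text \<open>Both sides of U^2 f = W^2 f^M have sparse expansions in powers of T^M, since f^M = f(T^M); comparing
  their leading digits gives u^2 f = w^2.\<close>
lemma auxiliary_polynomial_nonzero:
  fixes f :: "'a poly" and u v :: "nat \<Rightarrow> 'a poly"
  assumes f: "lead_coeff f = 1" "degree f = d" "d > 0" "\<nexists>h. f = h\<^sup>2"
    and u: "\<And>j. j < J \<Longrightarrow> u j \<in> deg_lt m" and v: "\<And>j. j < J \<Longrightarrow> v j \<in> deg_lt m"
    and nz: "\<exists>j<J. u j \<noteq> 0 \<or> v j \<noteq> 0"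
    and M: "M = q ^ k" "2 * m + d \<le> M"
  shows "(\<Sum>j<J. (u j + v j * f ^ ((M - 1) div 2)) * monom 1 (M * j)) \<noteq> 0"
proof
  assume zero: "(\<Sum>j<J. (u j + v j * f ^ ((M - 1) div 2)) * monom 1 (M * j)) = 0"
  have f0: "f \<noteq> 0" using f by auto
  let ?U = "\<Sum>j<J. u j * monom 1 (M * j)" and ?W = "\<Sum>j<J. v j * monom 1 (M * j)"
  have "?U + ?W * f ^ ((M - 1) div 2) = (\<Sum>j<J. (u j + v j * f ^ ((M - 1) div 2)) * monom 1 (M * j))"
    unfolding sum_distrib_right sum.distrib[symmetric] by (intro sum.cong refl) (simp add: algebra_simps)
  then have "?U + ?W * f ^ ((M - 1) div 2) = 0" using zero by simp
  then have U: "?U = - (?W * f ^ ((M - 1) div 2))" by (simp add: eq_neg_iff_add_eq_0)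
  have oddM: "odd M" using odd_q M by simp
  then have e: "Suc ((M - 1) div 2 + (M - 1) div 2) = M" by (auto elim!: oddE)
  \<comment> \<open>Squaring turns f^((M - 1)/2) into f^(M - 1); the extra factor f completes it to
    f^M, to which Frobenius applies.\<close>
  have eq: "?U\<^sup>2 * f = ?W\<^sup>2 * f ^ M"
  proof -
    have "?U\<^sup>2 * f = ?W\<^sup>2 * f ^ Suc ((M - 1) div 2 + (M - 1) div 2)"
      unfolding U by (simp add: power2_eq_square power_add algebra_simps)
    then show ?thesis by (simp only: e)
  qed
  have nonzero: "(\<Sum>j<J. x j * monom 1 (M * j)) \<noteq> 0"
    if x: "\<And>j. j < J \<Longrightarrow> x j \<in> deg_lt m" and xnz: "\<exists>j<J. x j \<noteq> 0" for x :: "nat \<Rightarrow> 'a poly"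
  proof -
    obtain i b where ib: "i < J" "x i \<noteq> 0" "(\<Sum>j<J. x j * monom 1 (M * j)) = x i * monom 1 (M * i) + b"
        "b = 0 \<or> i > 0 \<and> b \<in> deg_lt (M * (i - 1) + m)"
      by (rule leading_digit[OF x xnz])
    have "b \<in> deg_lt (M * i)"
    proof (cases "b = 0")
      case False
      then have "M * (i - 1) + m \<le> M * i" using ib M by (cases i) auto
      then show ?thesis using ib False deg_lt_mono by blast
    qed simp
    moreover have "x i * monom 1 (M * i) \<notin> deg_lt (M * i)"
      using ib(2) by (auto simp: mem_deg_lt_iff degree_mult_eq degree_monom_eq monom_eq_0_iff)
    ultimately have "x i * monom 1 (M * i) \<noteq> - b" by (auto simp: deg_lt_def)
    then show ?thesis using ib by (simp add: eq_neg_iff_add_eq_0)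
  qed
  have "(\<exists>j<J. u j \<noteq> 0) \<and> (\<exists>j<J. v j \<noteq> 0)"
  proof (rule ccontr)
    assume "\<not> ?thesis"
    then consider "\<forall>j<J. u j = 0" "\<exists>j<J. v j \<noteq> 0" | "\<forall>j<J. v j = 0" "\<exists>j<J. u j \<noteq> 0" using nz by blast
    then show False
    proof cases
      case 1
      then have "?U = 0" by simp
      then have "?W = 0" using eq f0 by simp
      then show False using nonzero[of v] v 1 by blast
    next
      case 2
      then have "?W = 0" by simp
      then have "?U = 0" using eq f0 by simp
      then show False using nonzero[of u] u 2 by blast
    qed
  qed
  then have unz: "\<exists>j<J. u j \<noteq> 0" and vnz: "\<exists>j<J. v j \<noteq> 0" by auto
  obtain i b where ib: "i < J" "u i \<noteq> 0" "?U = u i * monom 1 (M * i) + b"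
      "b = 0 \<or> i > 0 \<and> b \<in> deg_lt (M * (i - 1) + m)"
    by (rule leading_digit[OF u unz])
  obtain i' b' where ib': "i' < J" "v i' \<noteq> 0" "?W = v i' * monom 1 (M * i') + b'"
      "b' = 0 \<or> i' > 0 \<and> b' \<in> deg_lt (M * (i' - 1) + m)"
    by (rule leading_digit[OF v vnz])
  have fV: "f \<in> deg_lt (Suc d)" using f by (simp add: deg_lt_degree_le)
  obtain \<beta> where \<beta>: "\<beta> \<in> deg_lt (M * (2 * i))" "?U\<^sup>2 * f = ((u i)\<^sup>2 * f) * monom 1 (M * (2 * i)) + \<beta>"
    using leading_digit_square[OF u[OF ib(1)] ib(4) fV M(2)] unfolding ib(3) by blast
  have one: "1 \<in> deg_lt (Suc 0)" by (simp add: deg_lt_degree_le)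
  have M0: "2 * m + 0 \<le> M" using M by simp
  obtain \<gamma> where \<gamma>: "\<gamma> \<in> deg_lt (M * (2 * i'))" "?W\<^sup>2 * 1 = ((v i')\<^sup>2 * 1) * monom 1 (M * (2 * i')) + \<gamma>"
    using leading_digit_square[OF v[OF ib'(1)] ib'(4) one M0] unfolding ib'(3) by blast
  \<comment> \<open>By Frobenius, f^M is T^(M d) plus an M-th power of degree at most (d - 1) M, so
    the leading digit of f^M is 1 with a full gap below it.\<close>
  define \<phi> where "\<phi> = (f - monom 1 d) ^ M"
  have fM: "f ^ M = monom 1 (M * d) + \<phi>"
    using frobenius_diff[of f "monom 1 d" k] by (simp add: \<phi>_def M q_def monom_power mult.commute)
  have "f - monom 1 d \<in> deg_lt d" using f by (auto simp: deg_lt_def coeff_eq_0 le_less)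
  then have "f - monom 1 d \<in> deg_lt (Suc (d - 1))" using f by simp
  then have \<phi>: "\<phi> \<in> deg_lt (Suc ((d - 1) * M))" unfolding \<phi>_def by (rule deg_lt_power)
  have Md: "(d - 1) * M + M = M * d" using f by (cases d) auto
  have v2: "(v i')\<^sup>2 \<in> deg_lt (2 * m)" unfolding power2_eq_square
    by (rule deg_lt_mult[OF v[OF ib'(1)] v[OF ib'(1)]]) simp
  have "?W\<^sup>2 \<in> deg_lt (2 * m + M * (2 * i'))"
  proof -
    have "(v i')\<^sup>2 * monom 1 (M * (2 * i')) \<in> deg_lt (2 * m + M * (2 * i'))"
      by (rule deg_lt_mult[OF v2 deg_lt_monom[of _ "Suc (M * (2 * i'))"]]) auto
    moreover have "\<gamma> \<in> deg_lt (2 * m + M * (2 * i'))" using \<gamma>(1) deg_lt_mono[of "M * (2 * i')" "2 * m + M * (2 * i')"] by auto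
    ultimately show ?thesis using \<gamma>(2) deg_lt_add by simp
  qed
  then have "?W\<^sup>2 * \<phi> \<in> deg_lt (M * (2 * i' + d))"
    by (rule deg_lt_mult[OF _ \<phi>]) (use M Md in \<open>simp add: distrib_left\<close>)
  moreover have "\<gamma> * monom 1 (M * d) \<in> deg_lt (M * (2 * i' + d))"
    by (rule deg_lt_mult[OF \<gamma>(1) deg_lt_monom[of _ "Suc (M * d)"]]) (auto simp: distrib_left)
  ultimately have \<delta>: "\<gamma> * monom 1 (M * d) + ?W\<^sup>2 * \<phi> \<in> deg_lt (M * (2 * i' + d))" by (intro deg_lt_add)
  have "?W\<^sup>2 * f ^ M = ?W\<^sup>2 * monom 1 (M * d) + ?W\<^sup>2 * \<phi>" by (simp only: fM distrib_left)
  also have "?W\<^sup>2 * monom 1 (M * d) = (v i')\<^sup>2 * (monom 1 (M * (2 * i')) * monom 1 (M * d)) + \<gamma> * monom 1 (M * d)"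
    using \<gamma>(2) by (simp only: mult_1_right distrib_right mult.assoc)
  also have "monom 1 (M * (2 * i')) * monom 1 (M * d) = (monom 1 (M * (2 * i' + d)) :: 'a poly)"
    by (simp add: mult_monom distrib_left)
  finally have WM: "?W\<^sup>2 * f ^ M = (v i')\<^sup>2 * monom 1 (M * (2 * i' + d)) + (\<gamma> * monom 1 (M * d) + ?W\<^sup>2 * \<phi>)"
    by (simp only: add.assoc)
  have u2: "(u i)\<^sup>2 * f \<in> deg_lt M"
  proof (rule deg_lt_mult[OF _ fV])
    show "(u i)\<^sup>2 \<in> deg_lt (2 * m)" unfolding power2_eq_square by (rule deg_lt_mult[OF u[OF ib(1)] u[OF ib(1)]]) simp
  qed (use M in simp)
  have v2': "(v i')\<^sup>2 \<in> deg_lt M" using v2 deg_lt_mono[of "2 * m" M] M by auto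
  have key: "(u i)\<^sup>2 * f = (v i')\<^sup>2"
    by (rule leading_digit_unique(2)[OF u2 _ \<beta>(1) v2' _ \<delta>]) (use ib ib' f0 eq \<beta>(2) WM in auto)
  then have "(u i)\<^sup>2 dvd (v i')\<^sup>2" by (metis dvd_triv_left)
  then have "u i dvd v i'" by (simp add: pow_divides_pow_iff)
  then obtain h where "v i' = u i * h" by blast
  then have "(u i)\<^sup>2 * f = (u i)\<^sup>2 * h\<^sup>2" using key by (simp add: power_mult_distrib)
  then have "f = h\<^sup>2" using ib by simp
  then show False using f by blast
qed

text \<open>Pigeonhole: the families (u, v) have 2 m J free coefficients, while the sum lies in a
  space of dimension \<open>?D\<close>, which J = k + d makes smaller. Since m is a power of q, m-th
  powers are additive, so the difference of two colliding families is a solution.\<close>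

lemma ex_small_solution:
  fixes f :: "'a poly" and a :: 'a
  assumes f: "degree f = d" "d > 0" and m: "m = q ^ g" "m = 2 * k + 1" and J: "J = k + d"
  obtains u v :: "nat \<Rightarrow> 'a poly" where "\<And>j. j < J \<Longrightarrow> u j \<in> deg_lt m" "\<And>j. j < J \<Longrightarrow> v j \<in> deg_lt m"
    "\<exists>j<J. u j \<noteq> 0 \<or> v j \<noteq> 0"
    "(\<Sum>j<J. ((u j) ^ m * f ^ k + smult a ((v j) ^ m)) * monom 1 j) = 0"
proof -
  let ?S = "{..<J} \<rightarrow>\<^sub>E (deg_lt m \<times> deg_lt m :: ('a poly \<times> 'a poly) set)"
  let ?\<Phi> = "\<lambda>c. \<Sum>j<J. ((fst (c j)) ^ m * f ^ k + smult a ((snd (c j)) ^ m)) * (monom 1 j :: 'a poly)"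
  \<comment> \<open>An m-th power has degree at most m (2k), f^k has degree at most d k, and J
    accounts for the factors T^j with j < J.\<close>
  let ?D = "m * (2 * k) + d * k + J"
  have pow: "x ^ m \<in> deg_lt (Suc (m * (2 * k)))" if "x \<in> deg_lt m" for x :: "'a poly"
    using deg_lt_power[of x "2 * k" m] that m by (simp add: mult.commute)
  have fk: "f ^ k \<in> deg_lt (Suc (d * k))" using deg_lt_power[of f d k] f by (simp add: deg_lt_degree_le)
  have sub: "?\<Phi> ` ?S \<subseteq> deg_lt ?D"
  proof (rule image_subsetI, rule deg_lt_sum)
    fix c j assume c: "c \<in> ?S" and j: "j \<in> {..<J}"
    then have cj: "fst (c j) \<in> deg_lt m" "snd (c j) \<in> deg_lt m" by (auto simp: PiE_def Pi_def mem_Times_iff)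
    have "(fst (c j)) ^ m * f ^ k \<in> deg_lt (Suc (m * (2 * k) + d * k))"
      by (rule deg_lt_mult[OF pow[OF cj(1)] fk]) simp
    moreover have "smult a ((snd (c j)) ^ m) \<in> deg_lt (Suc (m * (2 * k) + d * k))"
      using deg_lt_smult[OF pow[OF cj(2)], of a] deg_lt_mono[of "Suc (m * (2 * k))" "Suc (m * (2 * k) + d * k)"] by auto
    ultimately have "(fst (c j)) ^ m * f ^ k + smult a ((snd (c j)) ^ m) \<in> deg_lt (Suc (m * (2 * k) + d * k))"
      by (rule deg_lt_add)
    then show "((fst (c j)) ^ m * f ^ k + smult a ((snd (c j)) ^ m)) * monom 1 j \<in> deg_lt ?D"
      by (rule deg_lt_mult[OF _ deg_lt_monom[of j "Suc j"]]) (use j in auto)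
  qed
  have "?D < 2 * m * J"
  proof -
    have "k \<le> d * k" using f by (cases d) auto
    then have "d * k + k + d < 4 * (d * k) + 2 * d" using f by linarith
    moreover have "2 * m * J = m * (2 * k) + 4 * (d * k) + 2 * d" unfolding J m(2) by (simp add: algebra_simps)
    ultimately show ?thesis using J by simp
  qed
  then have "q ^ ?D < q ^ (2 * m * J)" using q_gt_2 by (intro power_strict_increasing) auto
  moreover have "card ?S = q ^ (2 * m * J)"
  proof -
    have "card ?S = (q ^ m * q ^ m) ^ J" by (simp add: card_PiE card_cartesian_product card_deg_lt_q)
    then show ?thesis by (simp only: power_mult[of q "m + m" J] mult_2 power_add)
  qed
  moreover have "card (?\<Phi> ` ?S) \<le> q ^ ?D"
    using card_mono[OF _ sub] by (simp add: card_deg_lt_q)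
  ultimately have "\<not> inj_on ?\<Phi> ?S" by (intro pigeonhole) simp
  then obtain c c' where c: "c \<in> ?S" "c' \<in> ?S" "?\<Phi> c = ?\<Phi> c'" "c \<noteq> c'" by (auto simp: inj_on_def)
  define u where "u = (\<lambda>j. fst (c j) - fst (c' j))"
  define v where "v = (\<lambda>j. snd (c j) - snd (c' j))"
  have "u j \<in> deg_lt m" "v j \<in> deg_lt m" if "j < J" for j
    using c(1,2) that unfolding u_def v_def by (auto intro!: deg_lt_diff simp: PiE_def Pi_def mem_Times_iff)
  moreover have "\<exists>j<J. u j \<noteq> 0 \<or> v j \<noteq> 0"
  proof (rule ccontr)
    assume "\<not> ?thesis"
    then have "c j = c' j" if "j < J" for j using that by (auto simp: u_def v_def prod_eq_iff)
    then have "c = c'" using c(1,2) by (intro PiE_ext[of c]) auto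
    with c show False by simp
  qed
  moreover have "(\<Sum>j<J. ((u j) ^ m * f ^ k + smult a ((v j) ^ m)) * monom 1 j) = 0"
  proof -
    have frob: "(x - y) ^ m = x ^ m - y ^ m" for x y :: "'a poly"
      using frobenius_diff[of x y g] by (simp add: m q_def)
    have "(\<Sum>j<J. ((u j) ^ m * f ^ k + smult a ((v j) ^ m)) * monom 1 j) = ?\<Phi> c - ?\<Phi> c'"
      unfolding u_def v_def frob sum_subtractf[symmetric]
      by (intro sum.cong refl) (simp add: algebra_simps smult_diff_right)
    then show ?thesis using c by simp
  qed
  ultimately show ?thesis using that by blast
qed

lemma prod_primes_dvd:
  fixes r :: "'a poly"
  assumes "finite A" "A \<subseteq> monic_irred_deg n" "\<And>P. P \<in> A \<Longrightarrow> P dvd r"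
  shows "\<Prod>A dvd r"
  using assms
proof (induction A rule: finite_induct)
  case (insert P A)
  have P: "P \<in> monic_irred_deg n" using insert by auto
  obtain c where c: "r = \<Prod>A * c" using insert by auto
  have "\<not> P dvd \<Prod>A"
  proof
    assume "P dvd \<Prod>A"
    then obtain R where R: "R \<in> A" "P dvd R"
      using prime_elem_dvd_prod_iff[OF insert(1) monic_irred_degD(2)[OF P], of "\<lambda>x. x"] by auto
    then have "R \<in> monic_irred_deg n" using insert by auto
    then have "P = R" using monic_irred_dvd_eq[OF P _ R(2)] by blast
    then show False using R insert by simp
  qed
  moreover have "P dvd \<Prod>A * c" using insert c by auto
  ultimately have "P dvd c" using monic_irred_degD(2)[OF P] by (simp add: prime_elem_dvd_mult_iff)
  then show ?case using insert c by (auto intro: mult_dvd_mono simp: mult.commute)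
qed simp

lemma frobenius_cong:
  fixes P x :: "'a poly"
  assumes P: "P \<in> monic_irred_deg n"
  shows "[x ^ (q ^ n) = x] (mod P)"
proof (cases "P dvd x")
  case True
  have "P dvd x ^ (q ^ n)" using True q_gt_2 by (intro dvd_trans[OF True] dvd_power) auto
  then show ?thesis using True by (simp add: cong_iff_dvd_diff)
next
  case False
  have "[x ^ (q ^ n - 1) * x = 1 * x] (mod P)"
    using fermat_poly[OF monic_irred_degD(2)[OF P] False] monic_irred_degD(3)[OF P]
    by (intro cong_mult) (auto simp: q_def)
  then show ?thesis using q_gt_2 by (simp flip: power_Suc2)
qed

text \<open>Stepanov's method. Taking the coefficients to be m-th powers, with m a power of q, replaces the usual
  high order of vanishing by a simple zero of the m-th root of the auxiliary polynomial, so that no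
  derivatives are needed.\<close>
lemma stepanov_bound:
  fixes f :: "'a poly"
  assumes f: "lead_coeff f = 1" "degree f = d" "d > 0" "\<nexists>h. f = h\<^sup>2"
    and d: "d \<le> q ^ g" and s: "s = 1 \<or> s = -1"
  shows "2 * ((2 * g + 1) * card {P \<in> monic_irred_deg (2 * g + 1). qr_prime f P = s}) \<le> q ^ (2 * g + 1) + 3 * d * q ^ (g + 1)"
proof -
  \<comment> \<open>m M = q^(2g+1) is the size of the residue field, and (m M - 1)/2 = k + K m
    splits the exponent in Euler's criterion between the equation solved for u, v and the m-th power
    of the auxiliary polynomial.\<close>
  define m where "m = q ^ g"
  define M where "M = q ^ (g + 1)"
  define k where "k = (m - 1) div 2"
  define K where "K = (M - 1) div 2"
  define J where "J = k + d"
  let ?N = "2 * g + 1"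
  have mk: "m = 2 * k + 1" using odd_q by (simp add: m_def k_def)
  have MK: "M = 2 * K + 1" using odd_q by (simp add: M_def K_def)
  have Q: "q ^ ?N = m * M" by (simp add: m_def M_def mult_2 flip: power_add)
  have mM: "2 * m + d \<le> M"
  proof -
    have "3 * m \<le> q * m" using q_gt_2 by (intro mult_right_mono) auto
    moreover have "M = q * m" "d \<le> m" using d by (simp_all add: M_def m_def)
    ultimately show ?thesis by linarith
  qed
  obtain u v :: "nat \<Rightarrow> 'a poly" where u: "\<And>j. j < J \<Longrightarrow> u j \<in> deg_lt m" and v: "\<And>j. j < J \<Longrightarrow> v j \<in> deg_lt m"
    and nz: "\<exists>j<J. u j \<noteq> 0 \<or> v j \<noteq> 0"
    and zero: "(\<Sum>j<J. ((u j) ^ m * f ^ k + smult (of_int s) ((v j) ^ m)) * monom 1 j) = 0"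
    using ex_small_solution[OF f(2,3) m_def mk J_def] by blast
  let ?r = "\<Sum>j<J. (u j + v j * f ^ K) * monom 1 (M * j)"
  have r0: "?r \<noteq> 0" unfolding K_def
    by (rule auxiliary_polynomial_nonzero[OF f u v nz M_def mM])
  \<comment> \<open>Modulo P, f^k times the m-th power of \<open>?r\<close> reduces to the sum in
    \<open>zero\<close>: T^(m M j) becomes T^j and f^(k + K m) becomes s.\<close>
  have dvd: "P dvd ?r" if P: "P \<in> monic_irred_deg ?N" and fP: "qr_prime f P = s" for P
  proof -
    note PD = monic_irred_degD[OF P]
    have "[f ^ ((q ^ ?N - 1) div 2) = of_int s] (mod P)"
      by (rule euler_criterion_odd_degree[OF P _ fP s]) simp
    moreover have "(q ^ ?N - 1) div 2 = k + K * m" using mk MK unfolding Q by (simp add: algebra_simps)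
    ultimately have eul: "[f ^ (k + K * m) = of_int s] (mod P)" by simp
    have rm: "?r ^ m = (\<Sum>j<J. ((u j) ^ m + (v j) ^ m * f ^ (K * m)) * monom 1 (q ^ ?N * j))"
    proof -
      have "?r ^ m = (\<Sum>j<J. ((u j + v j * f ^ K) * monom 1 (M * j)) ^ m)"
        using frobenius_sum[of _ _ g] by (simp add: m_def q_def)
      also have "\<dots> = (\<Sum>j<J. ((u j) ^ m + (v j) ^ m * f ^ (K * m)) * monom 1 (q ^ ?N * j))"
      proof (rule sum.cong[OF refl])
        fix j
        have "(u j + v j * f ^ K) ^ m = (u j) ^ m + (v j) ^ m * f ^ (K * m)"
          using frobenius_add[of "u j" "v j * f ^ K" g]
          by (simp add: m_def q_def power_mult_distrib power_mult)
        moreover have "monom 1 (M * j) ^ m = (monom 1 (q ^ ?N * j) :: 'a poly)"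
          unfolding Q by (simp add: monom_power mult_ac)
        ultimately show "((u j + v j * f ^ K) * monom 1 (M * j)) ^ m = ((u j) ^ m + (v j) ^ m * f ^ (K * m)) * monom 1 (q ^ ?N * j)"
          by (simp only: power_mult_distrib)
      qed
      finally show ?thesis .
    qed
    have "f ^ k * ?r ^ m = (\<Sum>j<J. ((u j) ^ m * f ^ k + (v j) ^ m * f ^ (k + K * m)) * monom 1 (q ^ ?N * j))"
      unfolding rm sum_distrib_left by (intro sum.cong refl) (simp add: power_add algebra_simps)
    moreover have "[(\<Sum>j<J. ((u j) ^ m * f ^ k + (v j) ^ m * f ^ (k + K * m)) * monom 1 (q ^ ?N * j)) =
        (\<Sum>j<J. ((u j) ^ m * f ^ k + (v j) ^ m * of_int s) * monom 1 j)] (mod P)"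
    proof (rule cong_sum)
      fix j
      have "[(monom 1 j) ^ (q ^ ?N) = monom 1 j] (mod P)" by (rule frobenius_cong[OF P])
      then have "[monom 1 (q ^ ?N * j) = monom 1 j] (mod P)" by (simp add: monom_power mult.commute)
      then show "[((u j) ^ m * f ^ k + (v j) ^ m * f ^ (k + K * m)) * monom 1 (q ^ ?N * j) =
        ((u j) ^ m * f ^ k + (v j) ^ m * of_int s) * monom 1 j] (mod P)"
        using eul by (intro cong_mult cong_add cong_refl)
    qed
    moreover have "(\<Sum>j<J. ((u j) ^ m * f ^ k + (v j) ^ m * of_int s) * monom 1 j) = 0"
      using zero by (simp add: of_int_poly mult.commute)
    ultimately have "P dvd f ^ k * ?r ^ m" by (simp add: cong_0_iff)
    moreover have "\<not> P dvd f" using fP s by (auto simp: qr_prime_def)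
    ultimately show ?thesis using prime_elem_dvd_mult_iff[OF PD(2)] prime_elem_dvd_power[OF PD(2)] by blast
  qed
  let ?A = "{P \<in> monic_irred_deg ?N. qr_prime f P = s}"
  have "\<Prod>?A dvd ?r" by (rule prod_primes_dvd[of _ ?N]) (auto intro: dvd)
  then have "degree (\<Prod>?A) \<le> degree ?r" using r0 by (rule dvd_imp_degree_le)
  moreover have "degree (\<Prod>?A) = (\<Sum>P\<in>?A. degree P)"
    by (rule degree_prod_sum_eq) (auto dest: monic_irred_degD(5))
  moreover have "(\<Sum>P\<in>?A. degree P) = (\<Sum>P\<in>?A. ?N)"
    by (intro sum.cong refl) (auto dest: monic_irred_degD(3))
  ultimately have "?N * card ?A \<le> degree ?r" by (simp add: mult.commute)
  moreover have "degree ?r < m + d * K + M * (J - 1)"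
  proof -
    have "?r \<in> deg_lt (m + d * K + M * (J - 1))"
    proof (rule deg_lt_sum)
      fix j assume "j \<in> {..<J}"
      then have j: "j < J" "M * j \<le> M * (J - 1)" by auto
      have "f ^ K \<in> deg_lt (Suc (d * K))" using deg_lt_power[of f d K] f by (simp add: deg_lt_degree_le)
      then have "v j * f ^ K \<in> deg_lt (m + d * K)" by (rule deg_lt_mult[OF v[OF j(1)]]) simp
      moreover have "u j \<in> deg_lt (m + d * K)" using u[OF j(1)] deg_lt_mono[of m "m + d * K"] by auto
      ultimately have "u j + v j * f ^ K \<in> deg_lt (m + d * K)" by (intro deg_lt_add)
      then show "(u j + v j * f ^ K) * monom 1 (M * j) \<in> deg_lt (m + d * K + M * (J - 1))"
        by (rule deg_lt_mult[OF _ deg_lt_monom[of _ "Suc (M * j)"]]) (use j in auto)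
    qed
    then show ?thesis using r0 by (simp add: mem_deg_lt_iff)
  qed
  ultimately have "?N * card ?A < m + d * K + M * (J - 1)" by simp
  \<comment> \<open>With J = k + d, the term M (J - 1) contributes M k, about m M / 2: the expected
    half of q^(2g+1). The rest is at most linear in d.\<close>
  moreover have "2 * (m + d * K + M * (J - 1)) \<le> m * M + 3 * d * M"
  proof -
    obtain d' where d': "d = Suc d'" using f by (cases d) auto
    have "2 * (d * K) \<le> d * M" using MK by simp
    moreover have "2 * (M * (J - 1)) = (m - 1) * M + 2 * (d' * M)"
      using mk J_def d' by (simp add: algebra_simps)
    moreover have "(m - 1) * M + M = m * M" using mk by simp
    moreover have "d * M = d' * M + M" using d' by simp
    ultimately show ?thesis using mM by simp
  qed
  ultimately show ?thesis unfolding Q M_def[symmetric] by simp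
qed

end

section \<open>The first moment\<close>

context odd_field
begin

section \<open>Square and nonsquare contributions in each degree\<close>

lemma card_monic_squares:
  "card {f \<in> (monic_deg n :: 'a poly set). \<exists>h. f = h\<^sup>2} = (if even n then q ^ (n div 2) else 0)"
proof (cases "even n")
  case True
  have "{f \<in> (monic_deg n :: 'a poly set). \<exists>h. f = h\<^sup>2} = (\<lambda>h. h\<^sup>2) ` monic_deg (n div 2)"
  proof (intro set_eqI iffI)
    fix f :: "'a poly" assume "f \<in> {f \<in> monic_deg n. \<exists>h. f = h\<^sup>2}"
    then obtain h where h: "f = h\<^sup>2" and f: "lead_coeff f = 1" "degree f = n"
      by (auto simp: monic_deg_def monic_def)
    have "h \<noteq> 0" using h f by auto
    then have deg: "degree h = n div 2" using h f by (simp add: degree_power_eq)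
    have "(lead_coeff h)\<^sup>2 = 1" using h f by (metis lead_coeff_power)
    then consider "lead_coeff h = 1" | "lead_coeff (- h) = 1" by (auto simp: power2_eq_1_iff)
    then show "f \<in> (\<lambda>h. h\<^sup>2) ` monic_deg (n div 2)"
    proof cases
      case 1
      then show ?thesis using h deg by (auto simp: monic_deg_def monic_def)
    next
      case 2
      then show ?thesis using h deg by (intro image_eqI[of _ _ "- h"]) (simp_all add: monic_deg_def monic_def)
    qed
  next
    fix f :: "'a poly" assume "f \<in> (\<lambda>h. h\<^sup>2) ` monic_deg (n div 2)"
    then obtain h where h: "f = h\<^sup>2" "lead_coeff h = 1" "degree h = n div 2"
      by (auto simp: monic_deg_def monic_def)
    then have "h \<noteq> 0" by auto
    then have "degree f = n" using h True by (simp add: degree_power_eq)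
    moreover have "lead_coeff f = 1" using h by (simp only: lead_coeff_power) simp
    ultimately show "f \<in> {f \<in> monic_deg n. \<exists>h. f = h\<^sup>2}" using h by (auto simp: monic_deg_def monic_def)
  qed
  moreover have "inj_on (\<lambda>h :: 'a poly. h\<^sup>2) (monic_deg (n div 2))"
  proof (rule inj_onI)
    fix h h' :: "'a poly" assume hh: "h \<in> monic_deg (n div 2)" "h' \<in> monic_deg (n div 2)" "h\<^sup>2 = h'\<^sup>2"
    have "h \<noteq> - h'"
    proof
      assume "h = - h'"
      then have "lead_coeff h = - lead_coeff h'" by (simp only: degree_minus coeff_minus)
      moreover have "lead_coeff h = 1" "lead_coeff h' = 1" using hh by (auto simp: monic_deg_def monic_def)
      ultimately have "(1 :: 'a) = - 1" by (simp only:)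
      then show False using eq_uminus_iff[of 1] by simp
    qed
    then show "h = h'" using hh(3) power2_eq_iff by blast
  qed
  ultimately show ?thesis using True by (simp add: card_image card_monic_deg q_def)
next
  case False
  have "{f \<in> (monic_deg n :: 'a poly set). \<exists>h. f = h\<^sup>2} = {}"
  proof (rule ccontr)
    assume "\<not> ?thesis"
    then obtain h :: "'a poly" where h: "h\<^sup>2 \<in> monic_deg n" by auto
    then have "h \<noteq> 0" by (auto simp: monic_deg_def monic_def)
    then have "n = 2 * degree h" using h by (simp add: monic_deg_def degree_power_eq)
    then show False using False by simp
  qed
  then show ?thesis using False by simp
qed

lemma not_dvd_monic_deg:
  fixes f P :: "'a poly"
  assumes "f \<in> monic_deg n" "P \<in> monic_irred_deg N" "n < N"
  shows "\<not> P dvd f"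
  using assms monic_irred_degD(3)[OF assms(2)] by (auto simp: monic_deg_def monic_def dest!: dvd_imp_degree_le)

lemma g_le_power: "g \<le> q ^ g"
  using less_exp[of g] power_mono[of 2 q g] q_gt_2 by (meson le_trans less_imp_le_nat zero_le)

text \<open>With x and y the two weighted counts, Stepanov bounds 2x and 2y from above and the prime
  count bounds x + y from below. Hence x - y = 2x - (x + y) is at most 3 n q^(g+1) + g q^g, and
  likewise y - x; n <= g gives the constant 4.\<close>

lemma nonsquare_character_sum:
  fixes f :: "'a poly"
  assumes f: "f \<in> monic_deg n" "n \<le> g" "\<nexists>h. f = h\<^sup>2"
  shows "\<bar>real (2 * g + 1) * (\<Sum>P\<in>monic_irred_deg (2 * g + 1). real_of_int (qr_prime f P))\<bar> \<le> 4 * real g * real q ^ (g + 1)"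
proof -
  let ?N = "2 * g + 1" and ?I = "monic_irred_deg (2 * g + 1) :: 'a poly set"
  let ?A = "\<lambda>s. {P \<in> ?I. qr_prime f P = s}"
  have lf: "lead_coeff f = 1" "degree f = n" using f by (auto simp: monic_deg_def monic_def)
  have n0: "n > 0"
  proof (rule ccontr)
    assume "\<not> n > 0"
    then have "f = 1" using lf by (auto elim!: degree_eq_zeroE simp: one_pCons)
    then have "f = 1\<^sup>2" by simp
    then show False using f by blast
  qed
  have nq: "n \<le> q ^ g" using f(2) g_le_power[of g] by simp
  have pm: "qr_prime f P = 1 \<or> qr_prime f P = -1" if "P \<in> ?I" for P
    using not_dvd_monic_deg[OF f(1) that] f(2) by (simp add: qr_prime_def)
  have I: "?I = ?A 1 \<union> ?A (-1)" using pm by auto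
  have "prime_count ?N = card (?A 1) + card (?A (-1))"
    unfolding prime_count_def by (subst I, rule card_Un_disjoint) auto
  then have count: "real (prime_count ?N) = real (card (?A 1)) + real (card (?A (-1)))" by simp
  have chars: "(\<Sum>P\<in>?I. real_of_int (qr_prime f P)) = real (card (?A 1)) - real (card (?A (-1)))"
  proof -
    have "(\<Sum>P\<in>?I. real_of_int (qr_prime f P)) = (\<Sum>P\<in>?A 1. real_of_int (qr_prime f P)) + (\<Sum>P\<in>?A (-1). real_of_int (qr_prime f P))"
      by (subst I, rule sum.union_disjoint) auto
    also have "(\<Sum>P\<in>?A 1. real_of_int (qr_prime f P)) = (\<Sum>P\<in>?A 1. 1)" by (intro sum.cong) auto
    also have "(\<Sum>P\<in>?A (-1). real_of_int (qr_prime f P)) = (\<Sum>P\<in>?A (-1). - 1)" by (intro sum.cong) auto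
    finally show ?thesis by simp
  qed
  have b: "2 * (real ?N * real (card (?A s))) \<le> real q ^ ?N + 3 * real n * real q ^ (g + 1)"
    if "s = 1 \<or> s = -1" for s
  proof -
    have "real (2 * (?N * card (?A s))) \<le> real (q ^ ?N + 3 * n * q ^ (g + 1))"
      using stepanov_bound[OF lf n0 f(3) nq that] by (simp only: of_nat_le_iff)
    then show ?thesis by (simp only: of_nat_add of_nat_mult of_nat_power of_nat_numeral)
  qed
  have lower: "real q ^ ?N \<le> real ?N * real (prime_count ?N) + real g * real q ^ g"
  proof -
    have "real (q ^ ?N) \<le> real (?N * prime_count ?N + g * q ^ g)" using prime_count_ge[of g] by (simp only: of_nat_le_iff)
    then show ?thesis by (simp only: of_nat_add of_nat_mult of_nat_power of_nat_numeral)
  qed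
  have "real g * real q ^ g \<le> real g * real q ^ (g + 1)"
    using q_gt_2 by (intro mult_left_mono power_increasing) auto
  moreover have "3 * real n * real q ^ (g + 1) \<le> 3 * real g * real q ^ (g + 1)"
    using f(2) by (intro mult_right_mono) auto
  moreover define x y where "x = real ?N * real (card (?A 1))" and "y = real ?N * real (card (?A (-1)))"
  have "2 * x \<le> real q ^ ?N + 3 * real n * real q ^ (g + 1)" unfolding x_def by (rule b) simp
  moreover have "2 * y \<le> real q ^ ?N + 3 * real n * real q ^ (g + 1)" unfolding y_def by (rule b) simp
  moreover have "real q ^ ?N \<le> x + y + real g * real q ^ g"
    using lower unfolding count distrib_left x_def y_def .
  moreover have "real ?N * (\<Sum>P\<in>?I. real_of_int (qr_prime f P)) = x - y"
    unfolding chars right_diff_distrib x_def y_def ..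
  ultimately show ?thesis by linarith
qed

text \<open>Degree n <= g keeps f prime to P, so each of the q^(n div 2) squares for even n
  contributes the full prime count; the at most q^n nonsquares are bounded term by term.\<close>

lemma sum_over_primes_of_coefficient:
  assumes n: "n \<le> g"
  shows "\<bar>(\<Sum>P\<in>(monic_irred_deg (2 * g + 1) :: 'a poly set). real (2 * g + 1) * real_of_int (\<Sum>f\<in>monic_deg n. qr_prime f P))
     - (if even n then real (2 * g + 1) * real (prime_count (2 * g + 1)) * real q ^ (n div 2) else 0)\<bar>
     \<le> real q ^ n * (4 * real g * real q ^ (g + 1))"
proof -
  let ?N = "2 * g + 1" and ?I = "monic_irred_deg (2 * g + 1) :: 'a poly set"
  let ?S = "{f \<in> (monic_deg n :: 'a poly set). \<exists>h. f = h\<^sup>2}"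
  let ?B = "{f \<in> (monic_deg n :: 'a poly set). \<nexists>h. f = h\<^sup>2}"
  let ?F = "\<lambda>f. real ?N * (\<Sum>P\<in>?I. real_of_int (qr_prime f P))"
  have "(\<Sum>P\<in>?I. real ?N * real_of_int (\<Sum>f\<in>monic_deg n. qr_prime f P)) = (\<Sum>f\<in>monic_deg n. ?F f)"
    unfolding of_int_sum sum_distrib_left by (rule sum.swap)
  also have "\<dots> = sum ?F ?S + sum ?F ?B"
    by (subst sum.union_disjoint[symmetric]) (auto intro!: sum.cong)
  also have "sum ?F ?S = (\<Sum>f\<in>?S. real ?N * real (prime_count ?N))"
  proof (rule sum.cong[OF refl])
    fix f assume f: "f \<in> ?S"
    then have fm: "f \<in> monic_deg n" by simp
    have "qr_prime f P = 1" if "P \<in> ?I" for P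
      using f not_dvd_monic_deg[OF fm that] n qr_prime_square by auto
    then show "?F f = real ?N * real (prime_count ?N)" by (simp add: prime_count_def)
  qed
  also have "\<dots> = (if even n then real ?N * real (prime_count ?N) * real q ^ (n div 2) else 0)"
    using card_monic_squares[of n] by simp
  finally have eq: "(\<Sum>P\<in>?I. real ?N * real_of_int (\<Sum>f\<in>monic_deg n. qr_prime f P))
     - (if even n then real ?N * real (prime_count ?N) * real q ^ (n div 2) else 0) = sum ?F ?B" by simp
  have "\<bar>sum ?F ?B\<bar> \<le> (\<Sum>f\<in>?B. \<bar>?F f\<bar>)" by (rule sum_abs)
  also have "\<dots> \<le> (\<Sum>f\<in>?B. 4 * real g * real q ^ (g + 1))"
    using nonsquare_character_sum[OF _ n] by (intro sum_mono) blast
  also have "\<dots> = real (card ?B) * (4 * real g * real q ^ (g + 1))" by simp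
  also have "\<dots> \<le> real q ^ n * (4 * real g * real q ^ (g + 1))"
  proof (rule mult_right_mono)
    have "card ?B \<le> card (monic_deg n :: 'a poly set)" by (rule card_mono) auto
    then have "real (card ?B) \<le> real (q ^ n)" by (simp only: card_monic_deg q_def of_nat_le_iff)
    then show "real (card ?B) \<le> real q ^ n" by simp
  qed simp
  finally show ?thesis unfolding eq .
qed

text \<open>The middle term n = g is its own mirror image and counts once, hence the unequal
  ranges.\<close>

lemma sum_symmetric_halves:
  fixes a :: "nat \<Rightarrow> real"
  assumes "\<And>n. n \<le> 2 * g \<Longrightarrow> a (2 * g - n) = a n"
  shows "(\<Sum>n<2 * g + 1. a n) = (\<Sum>n<g + 1. a n) + (\<Sum>n<g. a n)"
proof -
  have "(\<Sum>n<2 * g + 1. a n) = (\<Sum>n<g + 1. a n) + (\<Sum>n\<in>{g + 1..<2 * g + 1}. a n)"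
    unfolding lessThan_atLeast0 by (rule sum.atLeastLessThan_concat[symmetric]) auto
  also have "(\<Sum>n\<in>{g + 1..<2 * g + 1}. a n) = (\<Sum>n\<in>{g + 1..<2 * g + 1}. a (2 * g - n))"
    by (rule sum.cong) (simp_all add: assms)
  also have "\<dots> = (\<Sum>n<g. a n)"
    by (rule sum.reindex_bij_witness[where i = "\<lambda>n. 2 * g - n" and j = "\<lambda>n. 2 * g - n"]) auto
  finally show ?thesis .
qed

text \<open>At u = q^(-1/2) the functional equation makes the terms of degree n and 2g - n
  equal.\<close>

lemma L_half_eq:
  fixes P :: "'a poly"
  assumes q4: "q mod 4 = 1" and P: "P \<in> monic_irred_deg (2 * g + 1)"
  shows "L_half P = (\<Sum>n<g + 1. real_of_int (\<Sum>f\<in>monic_deg n. qr_prime f P) * (real q powr (-1/2)) ^ n)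
     + (\<Sum>n<g. real_of_int (\<Sum>f\<in>monic_deg n. qr_prime f P) * (real q powr (-1/2)) ^ n)"
proof -
  let ?x = "real q powr (-1/2)"
  let ?S = "\<lambda>n. real_of_int (\<Sum>f\<in>monic_deg n. qr_prime f P)"
  have x2: "?x\<^sup>2 * real q = 1" using q_gt_2 by (simp add: power2_eq_square flip: powr_add)
  have xq: "?x ^ (2 * k) * real q ^ k = 1" for k
  proof -
    have "?x ^ (2 * k) * real q ^ k = (?x\<^sup>2 * real q) ^ k" by (simp only: power_mult power_mult_distrib)
    then show ?thesis by (simp only: x2 power_one)
  qed
  have "L_half P = (\<Sum>n<2 * g + 1. ?S n * ?x ^ n)"
    unfolding L_half_def monic_irred_degD(3)[OF P] q_def[symmetric]
  proof (rule sum.cong[OF refl])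
    fix n
    have "(\<Sum>f\<in>monic_deg n. chi P f) = (\<Sum>f\<in>monic_deg n. qr_prime f P)"
      by (intro sum.cong refl chi_eq_qr_prime[OF q4 P]) (auto simp: monic_deg_def monic_def)
    then show "real_of_int (\<Sum>f\<in>monic_deg n. chi P f) * ?x ^ n = ?S n * ?x ^ n" by simp
  qed
  also have "\<dots> = (\<Sum>n<g + 1. ?S n * ?x ^ n) + (\<Sum>n<g. ?S n * ?x ^ n)"
  proof (rule sum_symmetric_halves)
    fix n assume n: "n \<le> 2 * g"
    have "?S (2 * g - n) = ?x ^ (2 * n) * (real q ^ n * ?S (2 * g - n))"
      using xq[of n] by (simp only: mult.assoc[symmetric] mult_1)
    also have "\<dots> = ?x ^ (2 * n) * (real q ^ g * ?S n)" using functional_equation[OF P n] by (simp only:)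
    finally have "?S (2 * g - n) * ?x ^ (2 * g - n) = (?x ^ (2 * n) * ?x ^ (2 * g - n)) * real q ^ g * ?S n"
      by (simp only: mult_ac)
    also have "?x ^ (2 * n) * ?x ^ (2 * g - n) = ?x ^ (2 * g) * ?x ^ n"
      using n by (simp add: add.commute flip: power_add)
    also have "?x ^ (2 * g) * ?x ^ n * real q ^ g * ?S n = (?x ^ (2 * g) * real q ^ g) * (?S n * ?x ^ n)"
      by (simp only: mult_ac)
    finally show "?S (2 * g - n) * ?x ^ (2 * g - n) = ?S n * ?x ^ n" by (simp only: xq mult_1)
  qed
  finally show ?thesis .
qed

text \<open>The factor q^(-n/2) exactly cancels the number of squares of even degree n, so every
  even n contributes the same amount; the error is of size g q^(n/2 + g + 1), largest at n =
  g.\<close>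

lemma weighted_coefficient_sum:
  assumes n: "n \<le> g"
  shows "\<bar>(\<Sum>P\<in>(monic_irred_deg (2 * g + 1) :: 'a poly set).
        real (2 * g + 1) * (real_of_int (\<Sum>f\<in>monic_deg n. qr_prime f P) * (real q powr (-1/2)) ^ n))
     - (if even n then real (2 * g + 1) * real (prime_count (2 * g + 1)) else 0)\<bar>
     \<le> 4 * real g * real q powr (3 / 2 * real g + 1)"
proof -
  let ?N = "2 * g + 1" and ?I = "monic_irred_deg (2 * g + 1) :: 'a poly set"
  let ?x = "real q powr (-1/2)"
  let ?T = "\<Sum>P\<in>?I. real ?N * real_of_int (\<Sum>f\<in>monic_deg n. qr_prime f P)"
  let ?c = "real ?N * real (prime_count ?N)"
  have q0: "real q > 0" "real q \<ge> 1" using q_gt_2 by auto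
  have xn: "?x ^ n = real q powr (- real n / 2)" using q0 by (simp add: powr_power)
  have main: "(if even n then ?c * real q ^ (n div 2) else 0) * ?x ^ n = (if even n then ?c else 0)"
  proof (cases "even n")
    case True
    then have "real q ^ (n div 2) * ?x ^ n = real q powr (real (n div 2)) * real q powr (- real n / 2)"
      using q0 by (simp only: xn powr_realpow)
    also have "\<dots> = 1" using True q0 by (simp add: real_of_nat_div flip: powr_add)
    finally show ?thesis using True by simp
  qed simp
  have "(\<Sum>P\<in>?I. real ?N * (real_of_int (\<Sum>f\<in>monic_deg n. qr_prime f P) * ?x ^ n)) = ?T * ?x ^ n"
    by (simp only: sum_distrib_right mult.assoc)
  then have "\<bar>(\<Sum>P\<in>?I. real ?N * (real_of_int (\<Sum>f\<in>monic_deg n. qr_prime f P) * ?x ^ n)) - (if even n then ?c else 0)\<bar>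
      = \<bar>?T - (if even n then ?c * real q ^ (n div 2) else 0)\<bar> * ?x ^ n"
    by (simp only: main[symmetric] left_diff_distrib[symmetric] abs_mult) (simp add: q0)
  also have "\<dots> \<le> (real q ^ n * (4 * real g * real q ^ (g + 1))) * ?x ^ n"
    by (intro mult_right_mono sum_over_primes_of_coefficient n) simp
  also have "\<dots> = 4 * real g * (real q powr real n * real q powr real (g + 1) * real q powr (- real n / 2))"
    by (simp only: xn powr_realpow[OF q0(1)] mult_ac)
  also have "\<dots> = 4 * real g * real q powr (real n / 2 + real g + 1)"
    by (simp flip: powr_add add: add_ac)
  also have "\<dots> \<le> 4 * real g * real q powr (3 / 2 * real g + 1)"
    using n q0 by (intro mult_left_mono powr_mono) auto
  finally show ?thesis .
qed

text \<open>The ranges contain g div 2 + 1 and (g + 1) div 2 even numbers, together g + 1. This is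
  the origin of the factor (log |P| + 1)/2.\<close>

lemma count_even: "(\<Sum>n<g + 1. if even n then c else 0) + (\<Sum>n<g. if even n then c else 0) = real (g + 1) * c"
  for c :: real
  by (induction g) (auto simp: algebra_simps)

lemma first_moment_estimate:
  assumes q4: "q mod 4 = 1"
  shows "\<bar>(\<Sum>P\<in>(monic_irred_deg (2 * g + 1) :: 'a poly set). log (real q) (poly_abs P) * L_half P)
     - real q ^ (2 * g + 1) / 2 * (real (2 * g + 1) + 1)\<bar> \<le> 9 * (real g + 1)\<^sup>2 * real q powr (3 / 2 * real g + 1)"
proof -
  let ?N = "2 * g + 1" and ?I = "monic_irred_deg (2 * g + 1) :: 'a poly set"
  let ?c = "real ?N * real (prime_count ?N)"
  let ?E = "4 * real g * real q powr (3 / 2 * real g + 1)"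
  let ?x = "real q powr (-1/2)"
  let ?t = "\<lambda>n. \<Sum>P\<in>?I. real ?N * (real_of_int (\<Sum>f\<in>monic_deg n. qr_prime f P) * ?x ^ n)"
  let ?e = "\<lambda>n :: nat. if even n then ?c else 0"
  have q1: "real q > 1" using q_gt_2 by auto
  have "(\<Sum>P\<in>?I. log (real q) (poly_abs P) * L_half P) =
     (\<Sum>P\<in>?I. (\<Sum>n<g + 1. real ?N * (real_of_int (\<Sum>f\<in>monic_deg n. qr_prime f P) * ?x ^ n))
       + (\<Sum>n<g. real ?N * (real_of_int (\<Sum>f\<in>monic_deg n. qr_prime f P) * ?x ^ n)))"
  proof (rule sum.cong[OF refl])
    fix P assume P: "P \<in> ?I"
    have "log (real q) (poly_abs P) = real ?N"
      using monic_irred_degD(3)[OF P] q1 by (simp only: poly_abs_def q_def[symmetric] log_nat_power) simp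
    then show "log (real q) (poly_abs P) * L_half P =
       (\<Sum>n<g + 1. real ?N * (real_of_int (\<Sum>f\<in>monic_deg n. qr_prime f P) * ?x ^ n))
       + (\<Sum>n<g. real ?N * (real_of_int (\<Sum>f\<in>monic_deg n. qr_prime f P) * ?x ^ n))"
      by (simp only: L_half_eq[OF q4 P] distrib_left sum_distrib_left)
  qed
  also have "\<dots> = (\<Sum>n<g + 1. ?t n) + (\<Sum>n<g. ?t n)"
    unfolding sum.distrib by (subst (1 2) sum.swap) (rule refl)
  finally have total: "(\<Sum>P\<in>?I. log (real q) (poly_abs P) * L_half P) = (\<Sum>n<g + 1. ?t n) + (\<Sum>n<g. ?t n)" .
  have part: "\<bar>(\<Sum>n<k. ?t n) - (\<Sum>n<k. ?e n)\<bar> \<le> real k * ?E" if "k \<le> g + 1" for k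
  proof -
    have "\<bar>(\<Sum>n<k. ?t n) - (\<Sum>n<k. ?e n)\<bar> = \<bar>\<Sum>n<k. ?t n - ?e n\<bar>" by (simp only: sum_subtractf)
    also have "\<dots> \<le> (\<Sum>n<k. \<bar>?t n - ?e n\<bar>)" by (rule sum_abs)
    also have "\<dots> \<le> (\<Sum>n<k. ?E)" using that by (intro sum_mono weighted_coefficient_sum) auto
    finally show ?thesis by simp
  qed
  have lower: "real q ^ ?N \<le> ?c + real g * real q ^ g"
  proof -
    have "real (q ^ ?N) \<le> real (?N * prime_count ?N + g * q ^ g)" using prime_count_ge[of g] by (simp only: of_nat_le_iff)
    then show ?thesis by (simp only: of_nat_add of_nat_mult of_nat_power)
  qed
  have upper: "?c \<le> real q ^ ?N"
  proof -
    have "real (?N * prime_count ?N) \<le> real (q ^ ?N)" using prime_count_le[of ?N] by (simp only: of_nat_le_iff)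
    then show ?thesis by (simp only: of_nat_add of_nat_mult of_nat_power of_nat_numeral)
  qed
  have err: "real q ^ g \<le> real q powr (3 / 2 * real g + 1)"
  proof -
    have "real q ^ g = real q powr real g" using q1 by (simp add: powr_realpow)
    also have "\<dots> \<le> real q powr (3 / 2 * real g + 1)" using q1 by (intro powr_mono) auto
    finally show ?thesis .
  qed
  have "real q ^ ?N / 2 * (real ?N + 1) = real (g + 1) * real q ^ ?N" by simp
  moreover have "\<bar>real (g + 1) * ?c - real (g + 1) * real q ^ ?N\<bar> \<le> real (g + 1) * (real g * real q powr (3 / 2 * real g + 1))"
  proof -
    have "real g * real q ^ g \<le> real g * real q powr (3 / 2 * real g + 1)" using err by (intro mult_left_mono) auto
    then have "\<bar>?c - real q ^ ?N\<bar> \<le> real g * real q powr (3 / 2 * real g + 1)" using lower upper by linarith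
    then have "real (g + 1) * \<bar>?c - real q ^ ?N\<bar> \<le> real (g + 1) * (real g * real q powr (3 / 2 * real g + 1))"
      by (intro mult_left_mono) auto
    then show ?thesis by (simp add: abs_mult flip: right_diff_distrib)
  qed
  ultimately have "\<bar>(\<Sum>P\<in>?I. log (real q) (poly_abs P) * L_half P) - real q ^ ?N / 2 * (real ?N + 1)\<bar>
      \<le> real (g + 1) * ?E + real g * ?E + real (g + 1) * (real g * real q powr (3 / 2 * real g + 1))"
    using part[of "g + 1"] part[of g] count_even[of ?c g] unfolding total by linarith
  also have "\<dots> = (real (g + 1) * 4 * real g + real g * 4 * real g + real (g + 1) * real g) * real q powr (3 / 2 * real g + 1)"
    by (simp add: algebra_simps)
  \<comment> \<open>The 9 collects 4 + 4 from the two halves and 1 from the prime count.\<close>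
  also have "\<dots> \<le> (9 * (real g + 1)\<^sup>2) * real q powr (3 / 2 * real g + 1)"
    by (intro mult_right_mono) (auto simp: power2_eq_square algebra_simps)
  finally show ?thesis .
qed

end

text \<open>The square of g + 1 is absorbed by q^(2 \<epsilon> g), which is exp (c g) for the c
  chosen here; the remaining offset 1/4 - \<epsilon> in the exponent is a constant factor.\<close>

lemma square_times_power_bigo:
  fixes q \<epsilon> :: real
  assumes "q > 1" "\<epsilon> > 0"
  shows "(\<lambda>g. 9 * (real g + 1)\<^sup>2 * q powr (3 / 2 * real g + 1)) \<in> O(\<lambda>g. (q ^ (2 * g + 1)) powr (3 / 4 + \<epsilon>))"
proof -
  define c where "c = 2 * \<epsilon> * ln q"
  have c: "c > 0" using assms by (simp add: c_def)
  have "(\<lambda>g. (real g + 1)\<^sup>2) \<in> O(\<lambda>g. exp (c * real g))"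
  proof (rule bigoI[where c = "2 / c\<^sup>2 * exp c"], rule always_eventually, rule allI)
    fix g :: nat
    have "(c * (real g + 1))\<^sup>2 / 2 \<le> exp (c * (real g + 1))"
    proof -
      have "0 \<le> c * (real g + 1)" using c by simp
      then show ?thesis using exp_lower_Taylor_quadratic[of "c * (real g + 1)"] by linarith
    qed
    then have "c\<^sup>2 * (real g + 1)\<^sup>2 \<le> 2 * exp (c * (real g + 1))"
      unfolding power_mult_distrib by simp
    then have "(real g + 1)\<^sup>2 \<le> 2 / c\<^sup>2 * exp (c * (real g + 1))" using c by (simp add: field_simps)
    also have "exp (c * (real g + 1)) = exp c * exp (c * real g)" by (simp add: distrib_left mult_exp_exp add.commute)
    finally show "norm ((real g + 1)\<^sup>2) \<le> 2 / c\<^sup>2 * exp c * norm (exp (c * real g))" by simp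
  qed
  then have "(\<lambda>g. (real g + 1)\<^sup>2 * q powr (3 / 2 * real g + 3 / 4 + \<epsilon>))
      \<in> O(\<lambda>g. exp (c * real g) * q powr (3 / 2 * real g + 3 / 4 + \<epsilon>))"
    by (rule landau_o.big.mult[OF _ landau_o.big_refl])
  then have "(\<lambda>g. (9 * q powr (1 / 4 - \<epsilon>)) * ((real g + 1)\<^sup>2 * q powr (3 / 2 * real g + 3 / 4 + \<epsilon>)))
      \<in> O(\<lambda>g. exp (c * real g) * q powr (3 / 2 * real g + 3 / 4 + \<epsilon>))"
    using assms by (subst landau_o.big.cmult_in_iff) auto
  moreover have "(9 * q powr (1 / 4 - \<epsilon>)) * ((real g + 1)\<^sup>2 * q powr (3 / 2 * real g + 3 / 4 + \<epsilon>)) =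
      9 * (real g + 1)\<^sup>2 * q powr (3 / 2 * real g + 1)" for g
  proof -
    have "q powr (1 / 4 - \<epsilon>) * q powr (3 / 2 * real g + 3 / 4 + \<epsilon>) = q powr (3 / 2 * real g + 1)"
      by (simp add: add.commute flip: powr_add)
    then show ?thesis by (metis (no_types, lifting) mult.assoc mult.left_commute)
  qed
  moreover have "exp (c * real g) * q powr (3 / 2 * real g + 3 / 4 + \<epsilon>) = (q ^ (2 * g + 1)) powr (3 / 4 + \<epsilon>)" for g
  proof -
    have "exp (c * real g) = q powr (2 * \<epsilon> * real g)" using assms by (simp add: powr_def c_def mult_ac)
    moreover have "(q ^ (2 * g + 1)) powr (3 / 4 + \<epsilon>) = q powr (real (2 * g + 1) * (3 / 4 + \<epsilon>))"
      using assms powr_realpow[of q "2 * g + 1"] by (simp only: powr_powr[symmetric])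
    moreover have "2 * \<epsilon> * real g + (3 / 2 * real g + 3 / 4 + \<epsilon>) = real (2 * g + 1) * (3 / 4 + \<epsilon>)"
      by (simp add: field_simps)
    ultimately show ?thesis by (simp only: powr_add[symmetric])
  qed
  ultimately show ?thesis by (simp only:)
qed

theorem theorem2p4:
  assumes "odd (card (UNIV::'a::{finite,field_gcd} set))"
    and "card (UNIV::'a set) mod 4 = 1"
    and "\<epsilon> > (0::real)"
  shows "(\<lambda>g::nat. (\<Sum>P\<in>(monic_irred_deg (2*g+1) :: 'a poly set).
             log (real (card (UNIV::'a set))) (poly_abs P) * L_half P)
           - (real (card (UNIV::'a set)) ^ (2*g+1) / 2) * (real (2*g+1) + 1))
         \<in> O(\<lambda>g. (real (card (UNIV::'a set)) ^ (2*g+1)) powr (3/4 + \<epsilon>))"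
proof -
  define q where "q = card (UNIV :: 'a set)"
  interpret odd_field "TYPE('a)" q
    by standard (use assms in \<open>simp_all add: q_def\<close>)
  have "real q > 1" using q_gt_2 by simp
  then have "(\<lambda>g. 9 * (real g + 1)\<^sup>2 * real q powr (3 / 2 * real g + 1)) \<in> O(\<lambda>g. (real q ^ (2 * g + 1)) powr (3 / 4 + \<epsilon>))"
    using assms(3) by (rule square_times_power_bigo)
  moreover have "(\<lambda>g. (\<Sum>P\<in>(monic_irred_deg (2 * g + 1) :: 'a poly set). log (real q) (poly_abs P) * L_half P)
      - (real q ^ (2 * g + 1) / 2) * (real (2 * g + 1) + 1)) \<in> O(\<lambda>g. 9 * (real g + 1)\<^sup>2 * real q powr (3 / 2 * real g + 1))"
  proof (rule bigoI[where c = 1], rule always_eventually, rule allI)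
    fix g
    show "norm ((\<Sum>P\<in>(monic_irred_deg (2 * g + 1) :: 'a poly set). log (real q) (poly_abs P) * L_half P)
      - (real q ^ (2 * g + 1) / 2) * (real (2 * g + 1) + 1)) \<le> 1 * norm (9 * (real g + 1)\<^sup>2 * real q powr (3 / 2 * real g + 1))"
      using first_moment_estimate[of g] assms(2) by (simp add: q_def abs_mult)
  qed
  ultimately show ?thesis unfolding q_def by (rule landau_o.big_trans[rotated])
qed

end
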